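(* Let $p$ be a prime and let $G$ be a metabelian $p$-group of nilpotency class $\mathrm{cl}(G)=c=m-1\ge 3$ and coclass $\mathrm{cc}(G)=1$ (which automatically implies that $G/G'$ is of type $(p,p)$). With the invariant $k$, generators $x,y$, maximal subgroups $U_1,\ldots,U_{p+1}$ and commutators $s_j$ as specified in the context, and with respect to the projection $\pi:G\to\pi(G)=G/\gamma_c(G)$ onto the parent, the restricted Artin pattern of $G$ reveals: (1) a unipolarization and partial stabilization, if the first maximal subgroup $U_1$ is abelian; more precisely $$\mathrm{Pol}_\pi(G)=\{1\},\ \mathrm{Stb}_\pi(G)=\{2,\ldots,p+1\}\iff U_1'=1,\ k=0;$$ (2) a nilpolarization and total stabilization, if all $p+1$ maximal subgroups $U_i$ of $G$ are non-abelian; more precisely $$\mathrm{Pol}_\pi(G)=\emptyset,\ \mathrm{Stb}_\pi(G)=\{1,\ldots,p+1\}\iff U_1'=\langle s_{m-k},\ldots,s_{m-1}\rangle=\gamma_{m-k}(G),\ k\ge 1.$$ In both cases, the commutator subgroups of the other maximal subgroups are given by $U_i'=\langle s_3,\ldots,s_{m-1}\rangle=\gamma_3(G)$ for $2\le i\le p+1$.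
   Context: Notation. $\gamma_1(G)=G$, $\gamma_j(G)=[\gamma_{j-1}(G),G]$, $G'=\gamma_2(G)$, $[a,b]=a^{-1}b^{-1}ab$. Here $|G|=p^m$; the coclass of a $p$-group of order $p^n$ and class $c$ is $n-c$. "Type $(p,p)$" means $C_p\times C_p$. $\chi_2(G)=\{g\in G\mid[g,u]\in\gamma_4(G)\text{ for all }u\in\gamma_2(G)\}$ is the two-step centralizer; it equals $G$ iff $m=3$. The invariant $k=k(G)\ge 0$ is defined by $[\chi_2(G),\gamma_2(G)]=\gamma_{m-k}(G)$, with $k=0$ for $3\le m\le 4$, $0\le k\le m-4$ for $m\ge 5$, and $0\le k\le\min(m-4,p-2)$ for $m\ge p+1$ (Miech). Generators $G=\langle x,y\rangle$ are selected with $x\in G\setminus\chi_2(G)$ (as $m\ge 4$) and $y\in\chi_2(G)\setminus G'$. Put $s_2=[y,x]$ and $s_j=[s_{j-1},x]\in\gamma_j(G)$ for $j\ge 3$. The maximal subgroups are ordered as $U_i=\langle g_i,G'\rangle$ with $g_1=y$ and $g_i=xy^{i-2}$ for $2\le i\le p+1$. With respect to the natural projection $\pi:G\to G/\gamma_c(G)$ (kernel $\gamma_c(G)=\gamma_{m-1}(G)$) and the family $(U_i)_{1\le i\le p+1}$: $\mathrm{Stb}_\pi(G)=\{i\mid\ker(\pi)\le U_i'\}$ and $\mathrm{Pol}_\pi(G)=\{i\mid\ker(\pi)\not\le U_i'\}$. These are the indices of the components of the restricted Artin pattern $(\tau(G),\varkappa(G))=((U_i/U_i')_i,(\ker T_{G,U_i})_i)$,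 $T_{G,U_i}:G\to U_i/U_i'$ the Artin transfer (Verlagerung), that remain fixed, resp. change, under passage to the parent. *)

theory Defs
  imports "HOL-Algebra.Algebra"
begin

definition commutator :: "('a, 'b) monoid_scheme \<Rightarrow> 'a \<Rightarrow> 'a \<Rightarrow> 'a" where
  "commutator G a b = inv\<^bsub>G\<^esub> a \<otimes>\<^bsub>G\<^esub> inv\<^bsub>G\<^esub> b \<otimes>\<^bsub>G\<^esub> a \<otimes>\<^bsub>G\<^esub> b"

definition commutator_subgroup :: "('a, 'b) monoid_scheme \<Rightarrow> 'a set \<Rightarrow> 'a set \<Rightarrow> 'a set" where
  "commutator_subgroup G H K = generate G {commutator G h k | h k. h \<in> H \<and> k \<in> K}"

text \<open>The lower central series is indexed from 1, so that \<open>lower_central G j\<close> is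
  \<open>\<gamma>\<^sub>j(G)\<close>; the value at 0 is a dummy. The derived subgroup \<open>H'\<close> of a subgroup \<open>H\<close> is
  the library's \<open>derived G H\<close>, which is generated by the commutators
  \<open>a b a\<^sup>-\<^sup>1 b\<^sup>-\<^sup>1\<close> and hence coincides with \<open>commutator_subgroup G H H\<close>.\<close>

fun lower_central :: "('a, 'b) monoid_scheme \<Rightarrow> nat \<Rightarrow> 'a set" where
  "lower_central G 0 = carrier G"
| "lower_central G (Suc 0) = carrier G"
| "lower_central G (Suc (Suc n)) = commutator_subgroup G (lower_central G (Suc n)) (carrier G)"

definition metabelian :: "('a, 'b) monoid_scheme \<Rightarrow> bool" where
  "metabelian G \<longleftrightarrow> derived G (derived G (carrier G)) = {\<one>\<^bsub>G\<^esub>}"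

text \<open>Meaningful for nilpotent groups, in particular for finite \<open>p\<close>-groups.\<close>

definition nilpotency_class :: "('a, 'b) monoid_scheme \<Rightarrow> nat" where
  "nilpotency_class G = (LEAST c. lower_central G (Suc c) = {\<one>\<^bsub>G\<^esub>})"

text \<open>For a group of order \<open>p\<^sup>n\<close> the multiplicity is \<open>n\<close>.\<close>

definition coclass :: "nat \<Rightarrow> ('a, 'b) monoid_scheme \<Rightarrow> nat" where
  "coclass p G = multiplicity p (order G) - nilpotency_class G"

definition two_step_centralizer :: "('a, 'b) monoid_scheme \<Rightarrow> 'a set" where
  "two_step_centralizer G =
     {g \<in> carrier G. \<forall>u \<in> lower_central G 2. commutator G g u \<in> lower_central G 4}"

text \<open>The invariant \<open>k\<close> of a group of maximal class of order \<open>p\<^sup>m\<close>, determined by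
  \<open>[\<chi>\<^sub>2(G), \<gamma>\<^sub>2(G)] = \<gamma>\<^sub>m\<^sub>-\<^sub>k(G)\<close>. The condition \<open>k < m\<close> only keeps the index
  \<open>m - k\<close> positive; \<open>k\<close> is then unique because \<open>\<gamma>\<^sub>1(G) > \<dots> > \<gamma>\<^sub>m(G) = 1\<close> is strictly
  decreasing. The sharper bounds on \<open>k\<close> are theorems and are not built in.\<close>

definition invariant_k :: "('a, 'b) monoid_scheme \<Rightarrow> nat \<Rightarrow> nat" where
  "invariant_k G m = (THE k. k < m \<and>
     commutator_subgroup G (two_step_centralizer G) (lower_central G 2) = lower_central G (m - k))"

text \<open>\<open>s\<^sub>1 = y\<close> is a convention which yields \<open>s\<^sub>2 = [y, x]\<close> and
  \<open>s\<^sub>j = [s\<^sub>j\<^sub>-\<^sub>1, x]\<close>; the value at 0 is a dummy.\<close>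

fun iterated_commutator :: "('a, 'b) monoid_scheme \<Rightarrow> 'a \<Rightarrow> 'a \<Rightarrow> nat \<Rightarrow> 'a" where
  "iterated_commutator G x y 0 = y"
| "iterated_commutator G x y (Suc 0) = y"
| "iterated_commutator G x y (Suc (Suc n)) = commutator G (iterated_commutator G x y (Suc n)) x"

text \<open>For \<open>1 \<le> i \<le> p + 1\<close> these are the maximal subgroups
  \<open>U\<^sub>1 = \<langle>y, G'\<rangle>\<close> and \<open>U\<^sub>i = \<langle>x y\<^sup>i\<^sup>-\<^sup>2, G'\<rangle>\<close>.\<close>

definition maximal_subgroup_gen :: "('a, 'b) monoid_scheme \<Rightarrow> 'a \<Rightarrow> 'a \<Rightarrow> nat \<Rightarrow> 'a" where
  "maximal_subgroup_gen G x y i = (if i = 1 then y else x \<otimes>\<^bsub>G\<^esub> (y [^]\<^bsub>G\<^esub> (i - 2)))"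

definition maximal_subgroup :: "('a, 'b) monoid_scheme \<Rightarrow> 'a \<Rightarrow> 'a \<Rightarrow> nat \<Rightarrow> 'a set" where
  "maximal_subgroup G x y i =
     generate G (insert (maximal_subgroup_gen G x y i) (derived G (carrier G)))"

definition natural_projection :: "('a, 'b) monoid_scheme \<Rightarrow> 'a set \<Rightarrow> 'a \<Rightarrow> 'a set" where
  "natural_projection G N = (\<lambda>g. N #>\<^bsub>G\<^esub> g)"

text \<open>Stabilization and polarization of a family \<open>(U\<^sub>i)\<close> of subgroups of \<open>G\<close>, indexed by \<open>I\<close>,
  with respect to a homomorphism \<open>\<pi>\<close> from \<open>G\<close> to \<open>H\<close>.\<close>

definition stabilization ::
  "('a, 'b) monoid_scheme \<Rightarrow> ('c, 'd) monoid_scheme \<Rightarrow> ('a \<Rightarrow> 'c) \<Rightarrow> nat set \<Rightarrow> (nat \<Rightarrow> 'a set) \<Rightarrow> nat set"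
  where "stabilization G H \<pi> I U = {i \<in> I. kernel G H \<pi> \<subseteq> derived G (U i)}"

definition polarization ::
  "('a, 'b) monoid_scheme \<Rightarrow> ('c, 'd) monoid_scheme \<Rightarrow> ('a \<Rightarrow> 'c) \<Rightarrow> nat set \<Rightarrow> (nat \<Rightarrow> 'a set) \<Rightarrow> nat set"
  where "polarization G H \<pi> I U = {i \<in> I. \<not> kernel G H \<pi> \<subseteq> derived G (U i)}"

end

theory Submission
  imports Defs
begin

text \<open>Everything is decided inside \<open>A = G' = \<gamma>\<^sub>2(G)\<close>. As \<open>G\<close> is metabelian, \<open>A\<close> is abelian, and
  each \<open>g\<close> induces an endomorphism \<open>D\<^sub>g : u \<mapsto> [u, g]\<close> of \<open>A\<close>. Conjugation on \<open>A\<close> factors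
  through the abelian group \<open>G/A\<close>, so these endomorphisms commute. For a subgroup
  \<open>U = \<langle>g, A\<rangle>\<close> one has \<open>U' = D\<^sub>g A\<close>; so the derived subgroups of the maximal subgroups are
  images of such endomorphisms.

  Because \<open>y\<close> lies in the two-step centralizer, \<open>D\<^sub>y\<close> maps \<open>\<gamma>\<^sub>2\<close> into \<open>\<gamma>\<^sub>4\<close>, and by
  commutativity it maps every \<open>\<gamma>\<^sub>j\<close> into \<open>\<gamma>\<^sub>j\<^sub>+\<^sub>2\<close> (\<open>two_step_centralizer_raises_by_two\<close>).
  Since \<open>\<gamma>\<^sub>j\<^sub>+\<^sub>1 = D\<^sub>x \<gamma>\<^sub>j \<cdot> D\<^sub>y \<gamma>\<^sub>j\<close>, the second factor is negligible, and a downward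
  induction from \<open>\<gamma>\<^sub>m = 1\<close> gives \<open>D\<^sub>x \<gamma>\<^sub>j = \<gamma>\<^sub>j\<^sub>+\<^sub>1\<close> for all \<open>j \<ge> 2\<close>
  (\<open>ad_image_lower_central\<close>). Here \<open>x\<close> may be any element that generates \<open>G\<close> together with \<open>y\<close>, for
  instance \<open>x y\<^sup>e\<close>; with \<open>j = 2\<close> this is \<open>U\<^sub>i' = \<gamma>\<^sub>3\<close> for \<open>i \<ge> 2\<close>. It also shows that \<open>\<gamma>\<^sub>j\<close> is
  generated by \<open>s\<^sub>j, \<dots>, s\<^sub>m\<^sub>-\<^sub>1\<close> (\<open>lower_central_eq_generate\<close>).

  The group \<open>U\<^sub>1\<close> is the two-step centralizer itself (\<open>two_step_centralizer_eq\<close>), so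
  \<open>U\<^sub>1' = D\<^sub>y A = [\<chi>\<^sub>2(G), \<gamma>\<^sub>2]\<close>. This is a normal subgroup of \<open>G\<close> inside \<open>A\<close>, and in a group of
  maximal class every such subgroup is some \<open>\<gamma>\<^sub>j\<close> (\<open>normal_subgroup_of_A\<close>); hence \<open>k\<close> is
  well defined and \<open>U\<^sub>1' = \<gamma>\<^sub>m\<^sub>-\<^sub>k\<close>. The kernel of the projection is \<open>\<gamma>\<^sub>m\<^sub>-\<^sub>1 \<noteq> 1\<close>. It lies in
  \<open>\<gamma>\<^sub>3 = U\<^sub>i'\<close> for \<open>i \<ge> 2\<close>, and it lies in \<open>U\<^sub>1' = \<gamma>\<^sub>m\<^sub>-\<^sub>k\<close> exactly if \<open>k \<ge> 1\<close>.

  All counting rests on the orders \<open>|\<gamma>\<^sub>j| = p\<^sup>m\<^sup>-\<^sup>j\<close> for \<open>2 \<le> j \<le> m\<close>: the \<open>m - 1\<close> strict steps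
  from \<open>\<gamma>\<^sub>1\<close> down to \<open>\<gamma>\<^sub>m = 1\<close> use up the \<open>m\<close> factors \<open>p\<close> of the order, because the first step
  takes at least two of them: \<open>G/G'\<close> is not cyclic. That the series does reach \<open>1\<close> is the
  nilpotency of finite \<open>p\<close>-groups.\<close>

section \<open>Commutators modulo a normal subgroup\<close>

context group
begin

lemma inv_mult_cancel_left [simp]:
  "\<lbrakk>a \<in> carrier G; b \<in> carrier G\<rbrakk> \<Longrightarrow> inv a \<otimes> (a \<otimes> b) = b"
  "\<lbrakk>a \<in> carrier G; b \<in> carrier G\<rbrakk> \<Longrightarrow> a \<otimes> (inv a \<otimes> b) = b"
  by (simp_all add: m_assoc [symmetric])

lemmas commutator_simps = commutator_def m_assoc inv_mult_group

lemma commutator_closed [simp, intro]: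
  "\<lbrakk>a \<in> carrier G; b \<in> carrier G\<rbrakk> \<Longrightarrow> commutator G a b \<in> carrier G"
  by (simp add: commutator_def)

lemma commutator_eq_one_iff:
  assumes "a \<in> carrier G" "b \<in> carrier G"
  shows "commutator G a b = \<one> \<longleftrightarrow> a \<otimes> b = b \<otimes> a"
proof -
  have "commutator G a b = inv (b \<otimes> a) \<otimes> (a \<otimes> b)"
    using assms by (simp add: commutator_simps)
  then show ?thesis
    using assms by (metis inv_closed inv_equality inv_inv l_inv m_closed)
qed

lemma inv_commutator:
  "\<lbrakk>a \<in> carrier G; b \<in> carrier G\<rbrakk> \<Longrightarrow> inv (commutator G a b) = commutator G b a"
  by (simp add: commutator_simps)

lemma conjugate_eq_mult_commutator:
  "\<lbrakk>a \<in> carrier G; b \<in> carrier G\<rbrakk> \<Longrightarrow> inv b \<otimes> a \<otimes> b = a \<otimes> commutator G a b"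
  by (simp add: commutator_simps)

lemma commutator_mult_left:
  "\<lbrakk>a \<in> carrier G; b \<in> carrier G; h \<in> carrier G\<rbrakk> \<Longrightarrow>
   commutator G (a \<otimes> b) h = (inv b \<otimes> commutator G a h \<otimes> b) \<otimes> commutator G b h"
  by (simp add: commutator_simps)

lemma commutator_mult_right:
  "\<lbrakk>u \<in> carrier G; g \<in> carrier G; h \<in> carrier G\<rbrakk> \<Longrightarrow>
   commutator G u (g \<otimes> h) = commutator G u h \<otimes> (inv h \<otimes> commutator G u g \<otimes> h)"
  by (simp add: commutator_simps)

lemma commutator_inv_left:
  "\<lbrakk>a \<in> carrier G; h \<in> carrier G\<rbrakk> \<Longrightarrow>
   commutator G (inv a) h = a \<otimes> inv (commutator G a h) \<otimes> inv a"
  by (simp add: commutator_simps)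

lemma conjugate_commutator:
  "\<lbrakk>a \<in> carrier G; b \<in> carrier G; h \<in> carrier G\<rbrakk> \<Longrightarrow>
   h \<otimes> commutator G a b \<otimes> inv h
   = commutator G (h \<otimes> a \<otimes> inv h) (h \<otimes> b \<otimes> inv h)"
  by (simp add: commutator_simps)

lemma commutator_in_normal:
  assumes "N \<lhd> G" "a \<in> N" "h \<in> carrier G"
  shows "commutator G a h \<in> N" "commutator G h a \<in> N"
proof -
  interpret N: normal N G by fact
  have "inv a \<otimes> (inv h \<otimes> a \<otimes> h) \<in> N"
    using assms N.inv_op_closed1 by blast
  then show *: "commutator G a h \<in> N"
    using assms by (simp add: commutator_simps)
  have "inv (commutator G a h) \<in> N"
    using * by simp
  then show "commutator G h a \<in> N"
    using assms by (simp add: inv_commutator)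
qed

lemma normal_if_commutators:
  assumes H: "subgroup H G"
    and comm: "\<And>h g. h \<in> H \<Longrightarrow> g \<in> carrier G \<Longrightarrow> commutator G h g \<in> H"
  shows "H \<lhd> G"
proof (subst normal_inv_iff, intro conjI ballI H)
  interpret H: subgroup H G by fact
  fix g h assume gh: "g \<in> carrier G" "h \<in> H"
  then have "h \<otimes> commutator G h (inv g) \<in> H"
    using comm by blast
  then show "g \<otimes> h \<otimes> inv g \<in> H"
    using gh by (simp add: conjugate_eq_mult_commutator [symmetric])
qed

text \<open>In \<open>G/N\<close> this is the centralizer of the image of \<open>h\<close>.\<close>

lemma subgroup_centralizer_mod:
  assumes "N \<lhd> G" "h \<in> carrier G"
  shows "subgroup {g \<in> carrier G. commutator G g h \<in> N} G"
proof -
  interpret N: normal N G by fact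
  show ?thesis
  proof (intro subgroupI)
    show "{g \<in> carrier G. commutator G g h \<in> N} \<noteq> {}"
      using assms(2) by (auto simp: commutator_def intro!: exI[of _ \<one>])
  qed (use assms in \<open>auto simp: commutator_mult_left commutator_inv_left
          N.inv_op_closed1 N.inv_op_closed2\<close>)
qed

text \<open>This reduces statements about \<open>[H, K]\<close> modulo a normal subgroup to generators of \<open>H\<close> and \<open>K\<close>:
  centralizers in \<open>G/N\<close> are subgroups, so one argument can be extended after the other.\<close>

lemma commutator_generate_in_normal:
  assumes N: "N \<lhd> G" and S: "S \<subseteq> carrier G" and T: "T \<subseteq> carrier G"
    and ST: "\<And>s t. s \<in> S \<Longrightarrow> t \<in> T \<Longrightarrow> commutator G s t \<in> N"
    and "g \<in> generate G S" "h \<in> generate G T"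
  shows "commutator G g h \<in> N"
proof -
  interpret N: normal N G by fact
  have swap: "commutator G b a \<in> N"
    if "commutator G a b \<in> N" "a \<in> carrier G" "b \<in> carrier G" for a b
    using that inv_commutator N.m_inv_closed by metis
  have gS: "commutator G g t \<in> N" if t: "t \<in> T" for t
  proof -
    have "generate G S \<subseteq> {g \<in> carrier G. commutator G g t \<in> N}"
      using S T ST t by (intro generate_subgroup_incl subgroup_centralizer_mod N) auto
    then show ?thesis using assms by blast
  qed
  have g: "g \<in> carrier G"
    using assms generate_in_carrier by blast
  have "generate G T \<subseteq> {h \<in> carrier G. commutator G h g \<in> N}"
    using g T gS swap by (intro generate_subgroup_incl subgroup_centralizer_mod N) auto
  then show ?thesis using assms g swap by blast
qed

lemma commutator_in_commutator_subgroup: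
  "\<lbrakk>h \<in> H; k \<in> K\<rbrakk> \<Longrightarrow> commutator G h k \<in> commutator_subgroup G H K"
  unfolding commutator_subgroup_def by (blast intro: generate.incl)

lemma commutator_subgroup_least:
  assumes "subgroup L G" "\<And>h k. h \<in> H \<Longrightarrow> k \<in> K \<Longrightarrow> commutator G h k \<in> L"
  shows "commutator_subgroup G H K \<subseteq> L"
  unfolding commutator_subgroup_def using assms by (intro generate_subgroup_incl) auto

lemma commutator_subgroup_normal:
  assumes "H \<lhd> G" "K \<lhd> G"
  shows "commutator_subgroup G H K \<lhd> G"
proof -
  interpret H: normal H G by fact
  interpret K: normal K G by fact
  show ?thesis
    unfolding commutator_subgroup_def
  proof (rule normal_generateI)
    fix c g assume "c \<in> {commutator G h k |h k. h \<in> H \<and> k \<in> K}" and g: "g \<in> carrier G"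
    then obtain h k where hk: "c = commutator G h k" "h \<in> H" "k \<in> K" by blast
    with g have "g \<otimes> c \<otimes> inv g = commutator G (g \<otimes> h \<otimes> inv g) (g \<otimes> k \<otimes> inv g)"
      by (simp add: conjugate_commutator)
    with hk g show "g \<otimes> c \<otimes> inv g \<in> {commutator G h k |h k. h \<in> H \<and> k \<in> K}"
      using H.inv_op_closed2 K.inv_op_closed2 by blast
  qed auto
qed

text \<open>The two sides use different conventions for the commutator, \<open>a b a\<^sup>-\<^sup>1 b\<^sup>-\<^sup>1\<close> and
  \<open>a\<^sup>-\<^sup>1 b\<^sup>-\<^sup>1 a b\<close>; inverting \<open>a\<close> and \<open>b\<close> exchanges the generating sets.\<close>

lemma derived_eq_commutator_subgroup:
  assumes "subgroup H G"
  shows "derived G H = commutator_subgroup G H H"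
proof -
  interpret H: subgroup H G by fact
  have "derived_set G H = {commutator G h k |h k. h \<in> H \<and> k \<in> H}" (is "_ = ?C")
  proof (intro equalityI subsetI)
    fix c assume "c \<in> derived_set G H"
    then obtain a b where ab: "a \<in> H" "b \<in> H" "c = a \<otimes> b \<otimes> inv a \<otimes> inv b" by blast
    then have "c = commutator G (inv a) (inv b)" by (simp add: commutator_def)
    with ab show "c \<in> ?C" by blast
  next
    fix c assume "c \<in> ?C"
    then obtain a b where ab: "a \<in> H" "b \<in> H" "c = commutator G a b" by blast
    then have "c = inv a \<otimes> inv b \<otimes> inv (inv a) \<otimes> inv (inv b)" by (simp add: commutator_def)
    with ab show "c \<in> derived_set G H" by blast
  qed
  then show ?thesis by (simp add: derived_def commutator_subgroup_def)
qed

lemma comm_group_iff_derived_trivial: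
  assumes H: "subgroup H G"
  shows "comm_group (G\<lparr>carrier := H\<rparr>) \<longleftrightarrow> derived G H = {\<one>}"
proof
  assume "comm_group (G\<lparr>carrier := H\<rparr>)"
  then show "derived G H = {\<one>}"
    using comm_group.derived_eq_singleton[of "G\<lparr>carrier := H\<rparr>" H] derived_consistent[OF subset_refl H]
    by simp
next
  assume trivial: "derived G H = {\<one>}"
  have "a \<otimes> b = b \<otimes> a" if "a \<in> H" "b \<in> H" for a b
  proof -
    have "commutator G a b = \<one>"
      using that trivial derived_eq_commutator_subgroup[OF H]
        commutator_in_commutator_subgroup[of a H b H] by simp
    then show ?thesis
      using that subgroup.mem_carrier[OF H] by (simp add: commutator_eq_one_iff)
  qed
  then show "comm_group (G\<lparr>carrier := H\<rparr>)"
    by (intro group.group_comm_groupI subgroup_imp_group H) simp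
qed

section \<open>The lower central series\<close>

lemma lower_central_Suc:
  "1 \<le> j \<Longrightarrow> lower_central G (Suc j) = commutator_subgroup G (lower_central G j) (carrier G)"
  by (cases j) auto

lemma lower_central_normal: "lower_central G j \<lhd> G"
proof (induction j)
  case (Suc j)
  then show ?case
    by (cases j) (simp_all add: commutator_subgroup_normal normal_self)
qed (simp add: normal_self)

lemmas lower_central_subgroup = normal_imp_subgroup [OF lower_central_normal]

lemma lower_central_carrier: "u \<in> lower_central G j \<Longrightarrow> u \<in> carrier G"
  using lower_central_subgroup subgroup.mem_carrier by fast

lemma commutator_in_lower_central:
  assumes "1 \<le> j" "u \<in> lower_central G j" "g \<in> carrier G"
  shows "commutator G u g \<in> lower_central G (Suc j)"
  using assms by (simp add: lower_central_Suc commutator_in_commutator_subgroup)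

lemma lower_central_decseq: "i \<le> j \<Longrightarrow> lower_central G j \<subseteq> lower_central G i"
proof (induction rule: dec_induct)
  case (step n)
  have "lower_central G (Suc n) \<subseteq> lower_central G n"
  proof (cases "n = 0")
    case False
    have "commutator_subgroup G (lower_central G n) (carrier G) \<subseteq> lower_central G n"
      by (intro commutator_subgroup_least lower_central_subgroup
          commutator_in_normal lower_central_normal)
    with False show ?thesis by (simp add: lower_central_Suc)
  qed auto
  with step show ?case by blast
qed auto

lemma lower_central_2: "lower_central G 2 = derived G (carrier G)"
  by (simp add: numeral_2_eq_2 derived_eq_commutator_subgroup subgroup_self)

lemma lower_central_trivial:
  "\<lbrakk>lower_central G i = {\<one>}; i \<le> j\<rbrakk> \<Longrightarrow> lower_central G j = {\<one>}"
  using lower_central_decseq[of i j] subgroup.one_closed[OF lower_central_subgroup] by fast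

text \<open>A subgroup \<open>H\<close> between \<open>\<gamma>\<^sub>3\<close> and \<open>\<gamma>\<^sub>2\<close> is normal, since \<open>[H, G] \<subseteq> \<gamma>\<^sub>3\<close>. If it contains the
  commutators of the generators, they commute in \<open>G/H\<close>, and \<open>G/H\<close> is abelian.\<close>

lemma derived_subset_if_generators:
  assumes "generate G S = carrier G" "S \<subseteq> carrier G"
    and H: "subgroup H G" "lower_central G 3 \<subseteq> H" "H \<subseteq> lower_central G 2"
    and "\<And>s t. s \<in> S \<Longrightarrow> t \<in> S \<Longrightarrow> commutator G s t \<in> H"
  shows "lower_central G 2 \<subseteq> H"
proof -
  interpret H: subgroup H G by fact
  have "H \<lhd> G"
    using H commutator_in_lower_central[of 2]
    by (intro normal_if_commutators) (auto simp: numeral_3_eq_3 numeral_2_eq_2)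
  then have "commutator G g h \<in> H" if "g \<in> carrier G" "h \<in> carrier G" for g h
    using commutator_generate_in_normal[of H S S g h] assms that by auto
  then have "commutator_subgroup G (carrier G) (carrier G) \<subseteq> H"
    by (intro commutator_subgroup_least H)
  then show ?thesis by (simp add: numeral_2_eq_2)
qed

end

section \<open>Finite p-groups are nilpotent\<close>

locale p_group = group G for G (structure) +
  fixes p m :: nat
  assumes prime_p: "Factorial_Ring.prime p"
    and order_G: "order G = p ^ m"
begin

lemma finite_carrier: "finite (carrier G)"
proof -
  have "0 < order G"
    unfolding order_G using prime_gt_0_nat[OF prime_p] by simp
  then show ?thesis by (simp only: order_gt_0_iff_finite)
qed

lemma finite_subgroup: "subgroup H G \<Longrightarrow> finite H"
  using finite_carrier finite_subset subgroup.subset by blast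

lemma card_subgroup_prime_power:
  assumes "subgroup H G"
  obtains i where "i \<le> m" "card H = p ^ i"
proof -
  have "card H dvd p ^ m"
    using lagrange[OF assms] order_G by (metis dvd_triv_right)
  then show thesis
    using that divides_primepow_nat[OF prime_p] by blast
qed

lemma card_proper_subgroup:
  assumes "subgroup H G" "subgroup K G" "H \<subset> K"
  shows "p * card H \<le> card K"
proof -
  obtain i j where ij: "card H = p ^ i" "card K = p ^ j"
    using assms card_subgroup_prime_power by metis
  have "card H < card K"
    using assms finite_subgroup psubset_card_mono by blast
  then have "Suc i \<le> j"
    using ij power_less_imp_less_exp[OF prime_gt_1_nat[OF prime_p]] by (metis Suc_leI)
  then have "p ^ Suc i \<le> p ^ j"
    using prime_gt_0_nat[OF prime_p] by (intro power_increasing) auto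
  then show ?thesis using ij by simp
qed

text \<open>The class equation: if only the conjugacy class of \<open>1\<close> were a singleton, \<open>|G|\<close>
  would be congruent to \<open>1\<close> modulo \<open>p\<close>.\<close>

lemma nontrivial_centre:
  assumes "0 < m"
  obtains z where "z \<in> carrier G" "z \<noteq> \<one>" "\<And>g. g \<in> carrier G \<Longrightarrow> g \<otimes> z = z \<otimes> g"
proof (rule ccontr)
  assume "\<not> thesis"
  then have no_centre: "z = \<one>" if "z \<in> carrier G" "\<And>g. g \<in> carrier G \<Longrightarrow> g \<otimes> z = z \<otimes> g" for z
    using that \<open>\<And>z. \<lbrakk>z \<in> carrier G; z \<noteq> \<one>; \<And>g. g \<in> carrier G \<Longrightarrow> g \<otimes> z = z \<otimes> g\<rbrakk> \<Longrightarrow> thesis\<close>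
    by blast
  define \<phi> where "\<phi> = (\<lambda>g. \<lambda>h \<in> carrier G. g \<otimes> h \<otimes> inv g)"
  interpret act: group_action G "carrier G" \<phi>
    unfolding \<phi>_def by (rule action_by_conjugation)
  define \<O> where "\<O> = orbits G (carrier G) \<phi>"
  have fin: "finite \<O>"
    using finite_carrier by (simp add: \<O>_def orbits_def Setcompr_eq_image)
  have orbit_one: "orbit G \<phi> \<one> = {\<one>}"
    by (force simp: orbit_def \<phi>_def)
  have dvd: "p dvd card B" if B: "B \<in> \<O> - {{\<one>}}" for B
  proof -
    obtain z where z: "z \<in> carrier G" "B = orbit G \<phi> z"
      using B by (auto simp: \<O>_def orbits_def)
    then have "card B dvd p ^ m"
      using act.orbit_stabilizer_theorem order_G by (metis dvd_triv_left)
    moreover have "card B \<noteq> 1"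
    proof
      assume "card B = 1"
      moreover have "z \<in> B" using z act.orbit_refl by simp
      ultimately have "B = {z}" by (auto simp: card_1_singleton_iff)
      have "g \<otimes> z = z \<otimes> g" if g: "g \<in> carrier G" for g
      proof -
        have "g \<otimes> z \<otimes> inv g \<in> B"
          using z g by (auto simp: orbit_def \<phi>_def)
        then have "g \<otimes> z \<otimes> inv g = z" using \<open>B = {z}\<close> by simp
        then show ?thesis using z g by (metis inv_solve_right m_closed inv_closed)
      qed
      then have "z = \<one>" using no_centre z by blast
      then show False using \<open>B = {z}\<close> B by simp
    qed
    ultimately show ?thesis
      using divides_primepow_nat[OF prime_p] by (metis dvd_power gr0I power_0)
  qed
  have "{\<one>} \<in> \<O>"
    using orbit_one by (auto simp: \<O>_def orbits_def)
  have "order G = (\<Sum>B\<in>\<O>. card B)"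
    using act.disjoint_sum[OF finite_carrier, of "\<lambda>_. 1 :: nat"]
    by (simp add: \<O>_def order_def)
  also have "\<dots> = 1 + (\<Sum>B\<in>\<O> - {{\<one>}}. card B)"
    using \<open>{\<one>} \<in> \<O>\<close> fin by (simp add: sum.remove)
  finally have "p ^ m = 1 + (\<Sum>B\<in>\<O> - {{\<one>}}. card B)"
    by (simp add: order_G)
  moreover have "p dvd (\<Sum>B\<in>\<O> - {{\<one>}}. card B)"
    using dvd by (intro dvd_sum) auto
  moreover have "p dvd p ^ m" using assms by simp
  ultimately have "p dvd 1" by (metis dvd_add_left_iff)
  then show False using prime_p by simp
qed

end

lemma (in normal) coset_eq_iff:
  assumes "a \<in> carrier G" "b \<in> carrier G"
  shows "H #> a = H #> b \<longleftrightarrow> a \<otimes> inv b \<in> H"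
  using assms is_subgroup
  by (metis is_group rcos_module rcos_self repr_independence subgroup.subset)

lemma (in normal) group_hom_Mod: "group_hom G (G Mod H) (\<lambda>a. H #> a)"
  by (intro group_hom.intro group_hom_axioms.intro is_group factorgroup_is_group r_coset_hom_Mod)

context p_group
begin

lemma p_group_Mod:
  assumes "K \<lhd> G"
  obtains i where "p_group (G Mod K) p i" "p ^ i * card K = p ^ m"
proof -
  interpret K: normal K G by fact
  have eq: "order (G Mod K) * card K = p ^ m"
    using lagrange[OF K.is_subgroup] order_G by (simp add: order_def FactGroup_def)
  then obtain i where i: "order (G Mod K) = p ^ i"
    using prime_p by (metis dvd_triv_left divides_primepow_nat)
  then have "p_group (G Mod K) p i"
    by (intro p_group.intro p_group_axioms.intro K.factorgroup_is_group prime_p)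
  then show thesis using that eq i by simp
qed

text \<open>This is the step behind the nilpotency of \<open>p\<close>-groups.
  A proper normal subgroup \<open>K\<close> can be enlarged by a central element of \<open>G/K\<close>. If \<open>K\<close> is
  maximal among the normal subgroups that do not contain \<open>N\<close>, the enlarged subgroup
  contains \<open>N\<close>, and then \<open>[N, G] \<subseteq> K\<close>.\<close>

lemma normal_not_subset_commutator_subgroup:
  assumes N: "N \<lhd> G" "N \<noteq> {\<one>}"
  shows "\<not> N \<subseteq> commutator_subgroup G N (carrier G)"
proof -
  define S where "S = {K. K \<lhd> G \<and> \<not> N \<subseteq> K}"
  have "S \<subseteq> Pow (carrier G)"
    by (auto simp: S_def dest: normal_imp_subgroup subgroup.mem_carrier)
  then have fin: "finite S"
    using finite_carrier finite_subset by blast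
  have "\<one> \<in> N"
    using N normal_imp_subgroup subgroup.one_closed by blast
  then have "{\<one>} \<in> S"
    using N by (auto simp: S_def one_is_normal)
  then obtain K where "K \<in> S" and max: "\<And>L. L \<in> S \<Longrightarrow> K \<subseteq> L \<Longrightarrow> K = L"
    using finite_has_maximal[OF fin] by blast
  then have K: "K \<lhd> G" "\<not> N \<subseteq> K" by (auto simp: S_def)
  interpret K: normal K G by fact
  obtain i where i: "p_group (G Mod K) p i" "p ^ i * card K = p ^ m"
    using p_group_Mod[OF K(1)] by blast
  interpret Q: p_group "G Mod K" p i by fact
  interpret \<pi>: group_hom G "G Mod K" "\<lambda>a. K #> a" by (rule K.group_hom_Mod)
  have "0 < i"
  proof (rule gr0I)
    assume "i = 0"
    then have "card K = card (carrier G)" using i order_G by (simp add: order_def)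
    then have "K = carrier G" using finite_carrier card_subset_eq K.subset by blast
    then show False using K N by (meson normal_imp_subgroup subgroup.subset)
  qed
  then obtain z where z: "z \<in> carrier (G Mod K)" "z \<noteq> K"
    "\<And>w. w \<in> carrier (G Mod K) \<Longrightarrow> w <#> z = z <#> w"
    using Q.nontrivial_centre by auto
  obtain g where g: "g \<in> carrier G" "z = K #> g"
    using z(1) by (auto simp: carrier_FactGroup)
  have gK: "g \<notin> K" using g z(2) K.rcos_const by auto
  have comm: "commutator G g h \<in> K" if h: "h \<in> carrier G" for h
  proof -
    have "K #> (g \<otimes> h) = K #> (h \<otimes> g)"
    proof -
      have "(K #> h) <#> (K #> g) = (K #> g) <#> (K #> h)"
        using z(3)[of "K #> h"] g h by (auto simp: carrier_FactGroup)
      then show ?thesis using g h by (metis K.rcos_sum)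
    qed
    then have "(g \<otimes> h) \<otimes> inv (h \<otimes> g) \<in> K"
      using g h K.coset_eq_iff[of "g \<otimes> h" "h \<otimes> g"] by blast
    then have "inv (h \<otimes> g) \<otimes> ((g \<otimes> h) \<otimes> inv (h \<otimes> g)) \<otimes> (h \<otimes> g) \<in> K"
      using g h by (intro K.inv_op_closed1) auto
    then show ?thesis using g h by (simp add: commutator_simps)
  qed
  define L where "L = generate G (insert g K)"
  have incl: "insert g K \<subseteq> carrier G" using g K.subset by auto
  have L: "subgroup L G" "insert g K \<subseteq> L"
    using incl by (auto simp: L_def generate_is_subgroup intro: generate.incl)
  have comm_L: "commutator G l h \<in> K" if "l \<in> L" "h \<in> carrier G" for l h
    using commutator_generate_in_normal[OF K(1) incl, of "carrier G" l h] that comm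
      commutator_in_normal[OF K(1)] generate_incl[of "carrier G"]
    by (auto simp: L_def intro: generate.incl)
  then have "L \<lhd> G"
    using L by (intro normal_if_commutators) auto
  then have "N \<subseteq> L"
    using max[of L] L gK by (auto simp: S_def)
  then have "commutator_subgroup G N (carrier G) \<subseteq> K"
    using comm_L by (intro commutator_subgroup_least K.is_subgroup) auto
  then show ?thesis using K by auto
qed

lemma lower_central_strict:
  assumes "1 \<le> j" "lower_central G j \<noteq> {\<one>}"
  shows "lower_central G (Suc j) \<subset> lower_central G j"
  using normal_not_subset_commutator_subgroup[OF lower_central_normal assms(2)] assms(1)
    lower_central_decseq[of j "Suc j"] by (auto simp: lower_central_Suc)

text \<open>Otherwise the orders of the \<open>\<gamma>\<^sub>j\<close> would decrease strictly for ever.\<close>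

lemma lower_central_reaches_one: "\<exists>c. lower_central G (Suc c) = {\<one>}"
proof (rule ccontr)
  assume nontrivial: "\<not> ?thesis"
  have "card (lower_central G (Suc c)) + c \<le> order G" for c
  proof (induction c)
    case (Suc c)
    have "card (lower_central G (Suc (Suc c))) < card (lower_central G (Suc c))"
      using nontrivial
      by (intro psubset_card_mono finite_subgroup lower_central_subgroup lower_central_strict) auto
    with Suc show ?case by simp
  qed (simp add: order_def)
  \<comment> \<open>one step more than the order of the group leaves room for\<close>
  from this[of "Suc (order G)"] show False by simp
qed

text \<open>The class is defined as a least number; it has the defining property because such numbers exist.\<close>

lemma lower_central_nilpotency_class: "lower_central G (Suc (nilpotency_class G)) = {\<one>}"
  unfolding nilpotency_class_def by (rule LeastI_ex) (rule lower_central_reaches_one)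

lemma lower_central_nontrivial:
  assumes "1 \<le> j" "j \<le> nilpotency_class G"
  shows "lower_central G j \<noteq> {\<one>}"
proof -
  obtain i where i: "j = Suc i" using assms by (cases j) auto
  show ?thesis
    using not_less_Least[of i "\<lambda>c. lower_central G (Suc c) = {\<one>}"] assms i
    by (auto simp: nilpotency_class_def)
qed

end

section \<open>Groups of maximal class\<close>

locale maximal_class_group = p_group +
  assumes m_ge_3: "3 \<le> m"
    and maximal_class: "nilpotency_class G = m - 1"
begin

lemma lower_central_eq_one: "m \<le> j \<Longrightarrow> lower_central G j = {\<one>}"
  using lower_central_nilpotency_class maximal_class m_ge_3 lower_central_trivial[of m j] by simp

lemma lower_central_psubset:
  "\<lbrakk>1 \<le> j; j < m\<rbrakk> \<Longrightarrow> lower_central G (Suc j) \<subset> lower_central G j"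
  using lower_central_strict lower_central_nontrivial maximal_class by simp

lemma lower_central_inj:
  assumes "1 \<le> i" "i \<le> m" "1 \<le> j" "j \<le> m" "lower_central G i = lower_central G j"
  shows "i = j"
proof -
  have False if "1 \<le> i" "i < j" "j \<le> m" "lower_central G i = lower_central G j" for i j
    using that lower_central_psubset[of i] lower_central_decseq[of "Suc i" j] by auto
  then show ?thesis using assms by (metis nat_neq_iff)
qed

lemma order_split: "p ^ m = p ^ 2 * p ^ (m - 2)"
proof -
  have "m = 2 + (m - 2)" using m_ge_3 by simp
  then show ?thesis by (metis power_add)
qed

lemma card_lower_central_ge:
  assumes "1 \<le> j" "j \<le> m"
  shows "p ^ (m - j) \<le> card (lower_central G j)"
  using assms(2,1)
proof (induction rule: inc_induct)
  case base
  then show ?case by (simp add: lower_central_eq_one)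
next
  case (step j)
  then have "p ^ (m - j) = p * p ^ (m - Suc j)"
    by (metis Suc_diff_Suc power_Suc)
  also have "\<dots> \<le> p * card (lower_central G (Suc j))"
    using step by simp
  also have "\<dots> \<le> card (lower_central G j)"
    using step by (intro card_proper_subgroup lower_central_subgroup lower_central_psubset)
  finally show ?case .
qed

text \<open>If \<open>G/G'\<close> were cyclic, then \<open>G' = \<gamma>\<^sub>3\<close>, and the lower central series would be stationary.\<close>

lemma commutator_quotient_noncyclic:
  assumes g: "g \<in> carrier G"
  shows "generate G (insert g (lower_central G 2)) \<noteq> carrier G"
proof
  assume gen: "generate G (insert g (lower_central G 2)) = carrier G"
  have "commutator G s t \<in> lower_central G 3"
    if "s \<in> insert g (lower_central G 2)" "t \<in> insert g (lower_central G 2)" for s t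
  proof (cases "s \<in> lower_central G 2")
    case True
    then show ?thesis
      using that g commutator_in_lower_central[of 2 s t] lower_central_carrier[of t 2]
      by (auto simp: numeral_3_eq_3 numeral_2_eq_2)
  next
    case s: False
    show ?thesis
    proof (cases "t \<in> lower_central G 2")
      case True
      then have "commutator G t s \<in> lower_central G 3"
        using that g s commutator_in_lower_central[of 2 t s]
        by (auto simp: numeral_3_eq_3 numeral_2_eq_2)
      then show ?thesis
        using that True s g lower_central_carrier[of t 2]
        by (metis insertE inv_commutator lower_central_subgroup subgroup.m_inv_closed)
    next
      case False
      then show ?thesis
        using that s g commutator_eq_one_iff[of g g] subgroup.one_closed[OF lower_central_subgroup]
        by auto
    qed
  qed
  then have "lower_central G 2 \<subseteq> lower_central G 3"
    using g lower_central_carrier lower_central_decseq[of 2 3]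
    by (intro derived_subset_if_generators[OF gen] lower_central_subgroup) auto
  then show False
    using lower_central_psubset[of 2] m_ge_3 by (auto simp: numeral_3_eq_3 numeral_2_eq_2)
qed

text \<open>These proper inclusions \<open>G' \<subset> \<langle>g, G'\<rangle> \<subset> G\<close> force the index of \<open>G'\<close> to be at least
  \<open>p\<^sup>2\<close>; once it is known to be \<open>p\<^sup>2\<close>, they make \<open>\<langle>g, G'\<rangle>\<close> a maximal subgroup.\<close>

lemma lower_central_2_psubset_generate:
  assumes "g \<in> carrier G" "g \<notin> lower_central G 2"
  shows "subgroup (generate G (insert g (lower_central G 2))) G"
    and "lower_central G 2 \<subset> generate G (insert g (lower_central G 2))"
    and "generate G (insert g (lower_central G 2)) \<subset> carrier G"
proof -
  have incl: "insert g (lower_central G 2) \<subseteq> carrier G"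
    using assms lower_central_carrier by auto
  then show "subgroup (generate G (insert g (lower_central G 2))) G"
    by (rule generate_is_subgroup)
  show "lower_central G 2 \<subset> generate G (insert g (lower_central G 2))"
    using assms by (auto intro: generate.incl)
  show "generate G (insert g (lower_central G 2)) \<subset> carrier G"
    using commutator_quotient_noncyclic[OF assms(1)] generate_incl[OF incl] by auto
qed

lemma card_lower_central_2: "card (lower_central G 2) = p ^ (m - 2)"
proof (rule antisym)
  show "p ^ (m - 2) \<le> card (lower_central G 2)"
    using m_ge_3 by (intro card_lower_central_ge) auto
  obtain g where g: "g \<in> carrier G" "g \<notin> lower_central G 2"
    using lower_central_psubset[of 1] m_ge_3 by (auto simp: numeral_2_eq_2)
  note H = lower_central_2_psubset_generate[OF g]
  have "p * (p * card (lower_central G 2)) \<le> p * card (generate G (insert g (lower_central G 2)))"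
    using card_proper_subgroup[OF lower_central_subgroup H(1,2)] by simp
  also have "\<dots> \<le> p ^ m"
    using card_proper_subgroup[OF H(1) subgroup_self H(3)] order_G by (simp add: order_def)
  also have "\<dots> = p * (p * p ^ (m - 2))"
    by (simp add: order_split power2_eq_square)
  finally show "card (lower_central G 2) \<le> p ^ (m - 2)"
    using prime_gt_0_nat[OF prime_p] by simp
qed

lemma card_lower_central:
  assumes "2 \<le> j" "j \<le> m"
  shows "card (lower_central G j) = p ^ (m - j)"
  using assms
proof (induction rule: dec_induct)
  case (step j)
  have "p * card (lower_central G (Suc j)) \<le> card (lower_central G j)"
    using step by (intro card_proper_subgroup lower_central_subgroup lower_central_psubset) auto
  also have "\<dots> = p * p ^ (m - Suc j)"
    using step by (simp flip: power_Suc add: Suc_diff_Suc)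
  finally show ?case
    using card_lower_central_ge[of "Suc j"] step prime_gt_0_nat[OF prime_p] by simp
qed (rule card_lower_central_2)

text \<open>\<open>\<gamma>\<^sub>j\<^sub>+\<^sub>1\<close> has index \<open>p\<close> in \<open>\<gamma>\<^sub>j\<close>, so nothing fits strictly in between.\<close>

lemma subgroup_above_lower_central_Suc:
  assumes j: "2 \<le> j" "j < m" and H: "subgroup H G"
    and "lower_central G (Suc j) \<subset> H" "H \<subseteq> lower_central G j"
  shows "H = lower_central G j"
proof -
  have "card (lower_central G j) = p * card (lower_central G (Suc j))"
    using j by (simp add: card_lower_central flip: power_Suc add: Suc_diff_Suc)
  also have "\<dots> \<le> card H"
    using assms by (intro card_proper_subgroup lower_central_subgroup)
  finally show ?thesis
    using assms card_seteq finite_subgroup lower_central_subgroup by metis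
qed

lemma order_commutator_quotient: "order (G Mod lower_central G 2) = p ^ 2"
proof -
  have "order (G Mod lower_central G 2) * p ^ (m - 2) = p ^ 2 * p ^ (m - 2)"
    using lagrange[OF lower_central_subgroup, of 2] order_G card_lower_central_2 order_split
    by (simp add: order_def FactGroup_def)
  then show ?thesis
    using prime_gt_0_nat[OF prime_p] by simp
qed

text \<open>In the quotient \<open>G/G'\<close> of order \<open>p\<^sup>2\<close> an element of order \<open>p\<^sup>2\<close> would be a generator.\<close>

lemma pow_p_in_lower_central_2:
  assumes g: "g \<in> carrier G"
  shows "g [^] p \<in> lower_central G 2"
proof -
  let ?A = "lower_central G 2"
  interpret A: normal ?A G by (rule lower_central_normal)
  interpret \<pi>: group_hom G "G Mod ?A" "\<lambda>a. ?A #> a" by (rule A.group_hom_Mod)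
  let ?a = "?A #> g"
  have a: "?a \<in> carrier (G Mod ?A)" using g by (rule \<pi>.hom_closed)
  have "\<pi>.H.ord ?a dvd p ^ 2"
    using \<pi>.H.ord_dvd_group_order[OF a] order_commutator_quotient by simp
  then obtain i where i: "i \<le> 2" "\<pi>.H.ord ?a = p ^ i"
    using divides_primepow_nat[OF prime_p] by metis
  have "i \<noteq> 2"
  proof
    assume "i = 2"
    then have "card (generate (G Mod ?A) {?a}) = card (carrier (G Mod ?A))"
      using \<pi>.H.generate_pow_card[OF a] order_commutator_quotient i by (simp add: order_def)
    moreover have "finite (carrier (G Mod ?A))"
      using finite_carrier by (simp add: carrier_FactGroup)
    ultimately have gen: "generate (G Mod ?A) {?a} = carrier (G Mod ?A)"
      using a \<pi>.H.generate_incl[of "{?a}"] by (intro card_subset_eq) auto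
    have incl: "insert g ?A \<subseteq> carrier G" using g A.subset by auto
    interpret L: subgroup "generate G (insert g ?A)" G
      by (rule generate_is_subgroup[OF incl])
    have "h \<in> generate G (insert g ?A)" if h: "h \<in> carrier G" for h
    proof -
      have "?A #> h \<in> (\<lambda>a. ?A #> a) ` generate G {g}"
        using gen h g \<pi>.generate_img[of "{g}"] \<pi>.hom_closed[OF h] by simp
      then obtain b where b: "b \<in> generate G {g}" "?A #> h = ?A #> b" by blast
      then have bG: "b \<in> carrier G" using generate_in_carrier[of "{g}"] g by auto
      have "h \<otimes> inv b \<in> generate G (insert g ?A)"
        using b bG h A.coset_eq_iff by (auto intro: generate.incl)
      moreover have "b \<in> generate G (insert g ?A)"
        using b mono_generate[of "{g}" "insert g ?A"] by auto
      ultimately have "h \<otimes> inv b \<otimes> b \<in> generate G (insert g ?A)" by blast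
      then show ?thesis using bG h by (simp add: m_assoc)
    qed
    then show False
      using commutator_quotient_noncyclic[OF g] L.subset by blast
  qed
  then have "\<pi>.H.ord ?a dvd p" using i le_imp_power_dvd[of i 1 p] by simp
  then have "?a [^]\<^bsub>G Mod ?A\<^esub> p = ?A"
    using \<pi>.H.pow_eq_id[OF a] by simp
  then have "?A #> (g [^] p) = ?A #> \<one>"
    using g A.subset by (simp add: \<pi>.hom_nat_pow)
  then have "g [^] p \<otimes> inv \<one> \<in> ?A"
    using g A.coset_eq_iff by blast
  then show ?thesis using g by simp
qed

text \<open>The elements \<open>x\<close> and \<open>y\<close> have order dividing \<open>p\<close> in \<open>G/G'\<close>, so \<open>(i, j) \<mapsto> x\<^sup>i y\<^sup>j G'\<close> is well
  defined modulo \<open>p\<close>. It is onto because \<open>x\<close> and \<open>y\<close> generate \<open>G\<close>, and one-to-one because both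
  groups have order \<open>p\<^sup>2\<close>.\<close>

lemma commutator_quotient_iso:
  assumes xy: "x \<in> carrier G" "y \<in> carrier G" and gen: "generate G {x, y} = carrier G"
  shows "G Mod derived G (carrier G) \<cong> integer_mod_group p \<times>\<times> integer_mod_group p"
proof -
  let ?A = "lower_central G 2"
  let ?Q = "G Mod ?A"
  let ?P = "integer_mod_group p \<times>\<times> integer_mod_group p"
  interpret A: normal ?A G by (rule lower_central_normal)
  interpret Q: comm_group ?Q
    using derived_quot_is_comm_group by (simp add: lower_central_2)
  interpret \<pi>: group_hom G ?Q "\<lambda>g. ?A #> g" by (rule A.group_hom_Mod)
  have p: "1 < p" using prime_p prime_gt_1_nat by blast
  have pow_p: "(?A #> g) [^]\<^bsub>?Q\<^esub> p = \<one>\<^bsub>?Q\<^esub>" if "g \<in> carrier G" for g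
    using that pow_p_in_lower_central_2[OF that] A.rcos_const A.is_subgroup
    by (simp add: \<pi>.hom_nat_pow [symmetric])
  have pow_mod: "(?A #> g) [^]\<^bsub>?Q\<^esub> (n mod int p) = (?A #> g) [^]\<^bsub>?Q\<^esub> n"
    if g: "g \<in> carrier G" for g and n :: int
  proof -
    have "int (Q.ord (?A #> g)) dvd int p"
      using pow_p[OF g] Q.pow_eq_id[OF \<pi>.hom_closed[OF g]] by simp
    then have "int (Q.ord (?A #> g)) dvd n - n mod int p"
      by (meson dvd_minus_mod dvd_trans)
    then show ?thesis using Q.int_pow_eq[OF \<pi>.hom_closed[OF g]] by blast
  qed
  define f where "f = (\<lambda>(i, j). (?A #> x) [^]\<^bsub>?Q\<^esub> (i :: int) \<otimes>\<^bsub>?Q\<^esub> (?A #> y) [^]\<^bsub>?Q\<^esub> (j :: int))"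
  note ab = \<pi>.hom_closed[OF xy(1)] \<pi>.hom_closed[OF xy(2)]
  have f_closed: "f ij \<in> carrier ?Q" for ij
    using Q.m_closed[OF Q.int_pow_closed[OF ab(1)] Q.int_pow_closed[OF ab(2)]]
    by (cases ij) (simp add: f_def)
  have interchange: "(a \<otimes>\<^bsub>?Q\<^esub> a') \<otimes>\<^bsub>?Q\<^esub> (b \<otimes>\<^bsub>?Q\<^esub> b') = (a \<otimes>\<^bsub>?Q\<^esub> b) \<otimes>\<^bsub>?Q\<^esub> (a' \<otimes>\<^bsub>?Q\<^esub> b')"
    if "a \<in> carrier ?Q" "a' \<in> carrier ?Q" "b \<in> carrier ?Q" "b' \<in> carrier ?Q" for a a' b b'
    using that by (simp add: Q.m_ac del: mult_FactGroup)
  have f_hom: "f \<in> hom ?P ?Q"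
  proof (rule homI)
    fix u v assume "u \<in> carrier ?P" "v \<in> carrier ?P"
    obtain i j i' j' where uv: "u = (i, j)" "v = (i', j')" by fastforce
    have "f (u \<otimes>\<^bsub>?P\<^esub> v) = (?A #> x) [^]\<^bsub>?Q\<^esub> (i + i') \<otimes>\<^bsub>?Q\<^esub> (?A #> y) [^]\<^bsub>?Q\<^esub> (j + j')"
      unfolding uv f_def by (simp only: DirProd_def monoid.simps mult_integer_mod_group
          case_prod_conv pow_mod[OF xy(1)] pow_mod[OF xy(2)])
    also have "\<dots> = f u \<otimes>\<^bsub>?Q\<^esub> f v"
      unfolding uv f_def case_prod_conv Q.int_pow_mult[OF ab(1)] Q.int_pow_mult[OF ab(2)]
      by (intro interchange Q.int_pow_closed ab)
    finally show "f (u \<otimes>\<^bsub>?P\<^esub> v) = f u \<otimes>\<^bsub>?Q\<^esub> f v" .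
  qed (rule f_closed)
  interpret f: group_hom ?P ?Q f
    by (intro group_hom.intro group_hom_axioms.intro f_hom DirProd_group group_integer_mod_group
        Q.is_group)
  have "carrier ?P = {0..<int p} \<times> {0..<int p}"
    using p by (simp add: DirProd_def carrier_integer_mod_group)
  then have card_P: "card (carrier ?P) = p ^ 2" and fin_P: "finite (carrier ?P)"
    and gens: "(1, 0) \<in> carrier ?P" "(0, 1) \<in> carrier ?P"
    using p by (simp_all add: card_cartesian_product power2_eq_square)
  have "f (1, 0) = ?A #> x" "f (0, 1) = ?A #> y"
    using ab unfolding f_def case_prod_conv
    by (simp_all add: Q.int_pow_1 int_pow_0 del: mult_FactGroup one_FactGroup)
  then have "{?A #> x, ?A #> y} \<subseteq> f ` carrier ?P"
    using gens by (metis empty_subsetI image_eqI insert_subset)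
  then have "generate ?Q {?A #> x, ?A #> y} \<subseteq> f ` carrier ?P"
    by (intro Q.generate_subgroup_incl f.img_is_subgroup)
  moreover have "generate ?Q {?A #> x, ?A #> y} = carrier ?Q"
    using \<pi>.generate_img[of "{x, y}"] xy gen by (simp add: carrier_FactGroup)
  ultimately have surj: "f ` carrier ?P = carrier ?Q"
    using f_closed by blast
  then have "inj_on f (carrier ?P)"
    using card_P order_commutator_quotient fin_P by (intro eq_card_imp_inj_on) (simp_all add: order_def)
  with surj have "f \<in> iso ?P ?Q"
    using f_hom by (simp add: iso_def bij_betw_def)
  then show ?thesis
    using group.iso_sym[OF f.G.is_group, of ?Q] unfolding is_iso_def lower_central_2 by blast
qed

end

section \<open>The module structure of the commutator subgroup\<close>

locale metabelian_group = group G for G (structure) +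
  assumes metabelian_G: "metabelian G"
begin

abbreviation "A \<equiv> lower_central G 2"

lemma A_comm:
  assumes "u \<in> A" "v \<in> A"
  shows "u \<otimes> v = v \<otimes> u"
proof -
  have "commutator G u v \<in> derived G A"
    using assms derived_eq_commutator_subgroup[OF lower_central_subgroup]
      commutator_in_commutator_subgroup by simp
  then show ?thesis
    using assms metabelian_G lower_central_carrier
    by (auto simp: metabelian_def lower_central_2 [symmetric] commutator_eq_one_iff)
qed

lemma commutator_eq_one: "\<lbrakk>u \<in> A; v \<in> A\<rbrakk> \<Longrightarrow> commutator G u v = \<one>"
  using A_comm lower_central_carrier by (simp add: commutator_eq_one_iff)

lemma commutator_in_A: "\<lbrakk>g \<in> carrier G; h \<in> carrier G\<rbrakk> \<Longrightarrow> commutator G g h \<in> A"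
  using commutator_in_lower_central[of 1 g h] by (simp add: numeral_2_eq_2)

lemma conjugate_A_cancel:
  assumes "u \<in> A" "v \<in> A"
  shows "inv v \<otimes> u \<otimes> v = u"
  using assms A_comm[OF assms] lower_central_carrier by (simp add: m_assoc)

lemma commutator_mult_A:
  assumes "u \<in> A" "v \<in> A" "g \<in> carrier G"
  shows "commutator G (u \<otimes> v) g = commutator G u g \<otimes> commutator G v g"
  using assms commutator_in_A[of u g] lower_central_carrier[of _ 2]
  by (simp add: commutator_mult_left conjugate_A_cancel)

lemma commutator_inv_A:
  assumes "u \<in> A" "g \<in> carrier G"
  shows "commutator G (inv u) g = inv (commutator G u g)"
proof -
  interpret A: normal A G by (rule lower_central_normal)
  have "commutator G (inv u) g \<otimes> commutator G u g = commutator G (inv u \<otimes> u) g"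
    using assms by (intro commutator_mult_A [symmetric]) auto
  also have "\<dots> = \<one>"
    using assms by (simp add: commutator_eq_one_iff)
  finally show ?thesis
    using assms by (intro inv_equality [symmetric]) auto
qed

text \<open>Conjugation on \<open>G'\<close> factors through the commutative group \<open>G/G'\<close>; so the endomorphisms
  \<open>u \<mapsto> [u, g]\<close> of \<open>G'\<close> commute with one another.\<close>

lemma commutator_commutator_commute:
  assumes u: "u \<in> A" and g: "g \<in> carrier G" and h: "h \<in> carrier G"
  shows "commutator G (commutator G u g) h = commutator G (commutator G u h) g"
proof -
  have uG: "u \<in> carrier G" using u lower_central_carrier by blast
  have *: "commutator G u (a \<otimes> b)
      = commutator G u a \<otimes> commutator G u b \<otimes> commutator G (commutator G u a) b"
    if a: "a \<in> carrier G" and b: "b \<in> carrier G" for a b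
  proof -
    have "commutator G u (a \<otimes> b)
        = commutator G u b \<otimes> (commutator G u a \<otimes> commutator G (commutator G u a) b)"
      using a b uG by (simp add: commutator_mult_right conjugate_eq_mult_commutator)
    also have "\<dots> = commutator G u a \<otimes> commutator G u b \<otimes> commutator G (commutator G u a) b"
      using A_comm[of "commutator G u a" "commutator G u b"] a b uG commutator_in_A
      by (simp add: m_assoc [symmetric])
    finally show ?thesis .
  qed
  \<comment> \<open>\<open>h g\<close> and \<open>g h\<close> differ by an element of \<open>A\<close>, which centralizes \<open>u\<close>; now expand
    \<open>[u, h g] = [u, g h]\<close> on both sides\<close>
  have "commutator G u (h \<otimes> g) = commutator G u (g \<otimes> h \<otimes> commutator G h g)"
    using g h by (simp add: commutator_simps)
  also have "\<dots> = commutator G u (g \<otimes> h)"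
  proof -
    have c: "commutator G h g \<in> A" "commutator G h g \<in> carrier G"
      using g h commutator_in_A by auto
    have "commutator G u (g \<otimes> h \<otimes> commutator G h g)
        = commutator G u (commutator G h g)
          \<otimes> (inv (commutator G h g) \<otimes> commutator G u (g \<otimes> h) \<otimes> commutator G h g)"
      using g h uG c(2) by (intro commutator_mult_right) auto
    also have "\<dots> = commutator G u (g \<otimes> h)"
      using g h c u uG commutator_in_A[of u "g \<otimes> h"]
      by (simp only: commutator_eq_one conjugate_A_cancel l_one commutator_closed m_closed)
    finally show ?thesis .
  qed
  finally have "commutator G u h \<otimes> commutator G u g \<otimes> commutator G (commutator G u h) g
      = commutator G u g \<otimes> commutator G u h \<otimes> commutator G (commutator G u g) h"
    using * g h by simp
  moreover have "commutator G u h \<otimes> commutator G u g = commutator G u g \<otimes> commutator G u h"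
    using A_comm commutator_in_A g h uG by blast
  ultimately show ?thesis
    using g h uG by (metis commutator_closed l_cancel m_closed)
qed

text \<open>On \<open>A\<close> the map \<open>u \<mapsto> [u, g]\<close> is a homomorphism, hence determined by generators even if the target
  \<open>H\<close> is not normal.\<close>

lemma commutator_generate_A:
  assumes H: "subgroup H G" and S: "S \<subseteq> A" and g: "g \<in> carrier G"
    and gens: "\<And>s. s \<in> S \<Longrightarrow> commutator G s g \<in> H" and u: "u \<in> generate G S"
  shows "commutator G u g \<in> H"
proof -
  interpret H: subgroup H G by fact
  interpret A: normal A G by (rule lower_central_normal)
  have "subgroup {u \<in> A. commutator G u g \<in> H} G"
  proof (rule subgroupI)
    have "commutator G \<one> g = \<one>"
      using g by (simp add: commutator_eq_one_iff)
    then show "{u \<in> A. commutator G u g \<in> H} \<noteq> {}"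
      by (simp only: ex_in_conv [symmetric]) (rule exI[of _ \<one>], simp)
  qed (use g in \<open>auto simp: commutator_mult_A commutator_inv_A\<close>)
  then have "generate G S \<subseteq> {u \<in> A. commutator G u g \<in> H}"
    using S gens by (intro generate_subgroup_incl) auto
  then show ?thesis using u by blast
qed

text \<open>The image of \<open>H\<close> under the endomorphism \<open>D\<^sub>g : u \<mapsto> [u, g]\<close>, which is multiplication by
  \<open>g - 1\<close> when \<open>A\<close> is regarded as a module over the group ring of \<open>G/A\<close>.\<close>

definition ad_image :: "'a \<Rightarrow> 'a set \<Rightarrow> 'a set" where
  "ad_image g H = (\<lambda>u. commutator G u g) ` H"

text \<open>The image \<open>D\<^sub>g H\<close> is a subgroup without passing to a generated one, and invariant under
  conjugation since every \<open>D\<^sub>h\<close> commutes with \<open>D\<^sub>g\<close>.\<close>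

lemma ad_image_normal:
  assumes H: "H \<lhd> G" "H \<subseteq> A" and g: "g \<in> carrier G"
  shows "ad_image g H \<lhd> G"
proof -
  interpret H: normal H G by fact
  have closed: "commutator G u g \<otimes> commutator G v g \<in> ad_image g H" if "u \<in> H" "v \<in> H" for u v
  proof -
    have "commutator G u g \<otimes> commutator G v g = commutator G (u \<otimes> v) g"
      using commutator_mult_A[OF subsetD[OF H(2) that(1)] subsetD[OF H(2) that(2)] g] by simp
    then show ?thesis using that by (simp add: ad_image_def)
  qed
  have sub: "subgroup (ad_image g H) G"
  proof (rule subgroupI)
    show "ad_image g H \<subseteq> carrier G" using g by (auto simp: ad_image_def)
    show "ad_image g H \<noteq> {}" using H.one_closed unfolding ad_image_def by blast
    fix a assume "a \<in> ad_image g H"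
    then obtain u where u: "u \<in> H" "a = commutator G u g" by (auto simp: ad_image_def)
    then have "inv a = commutator G (inv u) g"
      using commutator_inv_A[OF subsetD[OF H(2)] g] by simp
    then show "inv a \<in> ad_image g H" using u by (auto simp: ad_image_def)
    fix b assume "b \<in> ad_image g H"
    then show "a \<otimes> b \<in> ad_image g H" using u closed by (auto simp: ad_image_def)
  qed
  then show ?thesis
  proof (rule normal_if_commutators)
    fix a h assume "a \<in> ad_image g H" and h: "h \<in> carrier G"
    then obtain u where u: "u \<in> H" "a = commutator G u g" by (auto simp: ad_image_def)
    then have "commutator G a h = commutator G (commutator G u h) g"
      using H g h commutator_commutator_commute[of u g h] by auto
    moreover have "commutator G u h \<in> H"
      using u H h commutator_in_normal by blast
    ultimately show "commutator G a h \<in> ad_image g H" by (auto simp: ad_image_def)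
  qed
qed

lemma lower_central_subset_A: "2 \<le> j \<Longrightarrow> lower_central G j \<subseteq> A"
  by (rule lower_central_decseq)

lemma ad_image_subset: "\<lbrakk>1 \<le> j; g \<in> carrier G\<rbrakk> \<Longrightarrow> ad_image g (lower_central G j) \<subseteq> lower_central G (Suc j)"
  by (auto simp: ad_image_def commutator_in_lower_central)

text \<open>Modulo the normal subgroup \<open>D\<^sub>g A\<close> the generators of \<open>\<langle>g, A\<rangle>\<close> commute with one another. The second
  equation is the one that matches \<open>[\<chi>\<^sub>2(G), \<gamma>\<^sub>2(G)]\<close>.\<close>

lemma commutator_generate_insert_A:
  assumes g: "g \<in> carrier G"
  shows "commutator_subgroup G (generate G (insert g A)) (generate G (insert g A)) = ad_image g A"
    and "commutator_subgroup G (generate G (insert g A)) A = ad_image g A"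
proof -
  let ?U = "generate G (insert g A)"
  interpret A: normal A G by (rule lower_central_normal)
  interpret N: normal "ad_image g A" G
    using g by (intro ad_image_normal lower_central_normal) auto
  have incl: "insert g A \<subseteq> carrier G" using g by auto
  have ug: "commutator G u g \<in> ad_image g A" if "u \<in> A" for u
    using that by (auto simp: ad_image_def)
  have gu: "commutator G g u \<in> ad_image g A" if "u \<in> A" for u
    using N.m_inv_closed[OF ug[OF that]] that g by (simp add: inv_commutator)
  have uv: "commutator G u v \<in> ad_image g A" if "u \<in> A" "v \<in> A" for u v
    using that by (simp add: commutator_eq_one)
  have gg: "commutator G g g \<in> ad_image g A"
    using g commutator_eq_one_iff[of g g] by simp
  have gens: "commutator G s t \<in> ad_image g A" if "s \<in> insert g A" "t \<in> insert g A" for s t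
    using that by (elim insertE) (simp_all only: ug gu uv gg)
  have "commutator_subgroup G ?U ?U \<subseteq> ad_image g A"
    using commutator_generate_in_normal[OF N.normal_axioms incl incl gens]
    by (intro commutator_subgroup_least N.is_subgroup)
  moreover have "commutator_subgroup G ?U A \<subseteq> commutator_subgroup G ?U ?U"
    unfolding commutator_subgroup_def by (intro mono_generate) (auto intro: generate.incl)
  moreover have "ad_image g A \<subseteq> commutator_subgroup G ?U A"
  proof
    fix a assume "a \<in> ad_image g A"
    then obtain u where u: "u \<in> A" "a = commutator G u g" by (auto simp: ad_image_def)
    have "subgroup (commutator_subgroup G ?U A) G"
      unfolding commutator_subgroup_def
      using generate_in_carrier[OF incl] by (intro generate_is_subgroup) auto
    moreover have "commutator G g u \<in> commutator_subgroup G ?U A"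
      using u by (intro commutator_in_commutator_subgroup) (auto intro: generate.incl)
    ultimately show "a \<in> commutator_subgroup G ?U A"
      using u g inv_commutator[of g u] subgroup.m_inv_closed by fastforce
  qed
  ultimately show "commutator_subgroup G ?U ?U = ad_image g A" "commutator_subgroup G ?U A = ad_image g A"
    by auto
qed

lemma derived_generate_insert_A:
  assumes "g \<in> carrier G"
  shows "derived G (generate G (insert g A)) = ad_image g A"
proof -
  have "insert g A \<subseteq> carrier G" using assms lower_central_carrier by auto
  then show ?thesis
    using assms commutator_generate_insert_A(1) derived_eq_commutator_subgroup generate_is_subgroup
    by simp
qed

end

section \<open>Two generators, one of them in the two-step centralizer\<close>

locale metabelian_two_generated = metabelian_group +
  fixes x y
  assumes x: "x \<in> carrier G" and y: "y \<in> carrier G" and gen: "generate G {x, y} = carrier G"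
begin

text \<open>This is \<open>\<gamma>\<^sub>j\<^sub>+\<^sub>1 = D\<^sub>x \<gamma>\<^sub>j \<cdot> D\<^sub>y \<gamma>\<^sub>j\<close>: the right-hand side is normal, and modulo it \<open>\<gamma>\<^sub>j\<close> commutes
  with the generators \<open>x\<close> and \<open>y\<close>.\<close>

lemma lower_central_Suc_decompose:
  assumes j: "2 \<le> j" and w: "w \<in> lower_central G (Suc j)"
  obtains u v where "u \<in> lower_central G j" "v \<in> lower_central G j"
    "w = commutator G u x \<otimes> commutator G v y"
proof -
  let ?D = "\<lambda>g. ad_image g (lower_central G j)"
  let ?N = "?D x <#> ?D y"
  note sub_A = lower_central_subset_A[OF j]
  interpret Dx: normal "?D x" G
    using x sub_A by (intro ad_image_normal lower_central_normal)
  interpret Dy: normal "?D y" G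
    using y sub_A by (intro ad_image_normal lower_central_normal)
  have D_sub: "?D g \<subseteq> A" if "g \<in> carrier G" for g
    using that lower_central_carrier commutator_in_A by (auto simp: ad_image_def)
  have N: "subgroup ?N G"
    by (rule mult_norm_subgroup[OF Dx.normal_axioms Dy.is_subgroup])
  have "?N \<lhd> G"
  proof (rule normal_if_commutators[OF N])
    fix n h assume "n \<in> ?N" and h: "h \<in> carrier G"
    then obtain a b where ab: "a \<in> ?D x" "b \<in> ?D y" "n = a \<otimes> b" by (auto simp: set_mult_def)
    then have "commutator G n h = commutator G a h \<otimes> commutator G b h"
      using D_sub x y h commutator_mult_A[of a b h] by blast
    moreover have "commutator G a h \<in> ?D x" "commutator G b h \<in> ?D y"
      using ab h commutator_in_normal Dx.normal_axioms Dy.normal_axioms by blast+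
    ultimately show "commutator G n h \<in> ?N" by (auto simp: set_mult_def)
  qed
  moreover have "commutator G u t \<in> ?N" if u: "u \<in> lower_central G j" and t: "t \<in> {x, y}" for u t
  proof -
    have "commutator G u x \<otimes> \<one> \<in> ?N" "\<one> \<otimes> commutator G u y \<in> ?N"
      using u Dx.one_closed Dy.one_closed by (auto simp only: set_mult_def ad_image_def)
    then show ?thesis using t u x y lower_central_carrier by auto
  qed
  ultimately have "commutator G u g \<in> ?N" if "u \<in> lower_central G j" "g \<in> carrier G" for u g
    using that x y gen subgroup.subset[OF lower_central_subgroup]
    by (intro commutator_generate_in_normal[of ?N "lower_central G j" "{x, y}" u g])
       (auto intro: generate.incl)
  then have "lower_central G (Suc j) \<subseteq> ?N"
    using j N by (simp add: lower_central_Suc commutator_subgroup_least)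
  then have "w \<in> ?N" using w by blast
  then show thesis using that by (auto simp: set_mult_def ad_image_def)
qed

text \<open>The element \<open>y\<close> acts trivially on \<open>\<gamma>\<^sub>2/\<gamma>\<^sub>4\<close>, and this is inherited by all \<open>\<gamma>\<^sub>j/\<gamma>\<^sub>j\<^sub>+\<^sub>2\<close>,
  because \<open>u \<mapsto> [u, y]\<close> commutes with the maps that produce \<open>\<gamma>\<^sub>j\<^sub>+\<^sub>1\<close> from \<open>\<gamma>\<^sub>j\<close>.\<close>

lemma two_step_centralizer_raises_by_two:
  assumes chi: "y \<in> two_step_centralizer G" and j: "2 \<le> j" and u: "u \<in> lower_central G j"
  shows "commutator G u y \<in> lower_central G (Suc (Suc j))"
  using j u
proof (induction arbitrary: u rule: dec_induct)
  case base
  then have "commutator G y u \<in> lower_central G 4"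
    using chi by (auto simp: two_step_centralizer_def)
  then have "inv (commutator G y u) \<in> lower_central G 4"
    by (rule subgroup.m_inv_closed[OF lower_central_subgroup])
  then show ?case
    using base y lower_central_carrier by (simp add: inv_commutator eval_nat_numeral)
next
  case (step j)
  obtain v w where vw: "v \<in> lower_central G j" "w \<in> lower_central G j"
    "u = commutator G v x \<otimes> commutator G w y"
    using lower_central_Suc_decompose[OF step.hyps(1) step.prems] .
  have A: "v \<in> A" "w \<in> A" using vw lower_central_subset_A[OF step.hyps(1)] by auto
  then have G: "v \<in> carrier G" "w \<in> carrier G" using lower_central_carrier by auto
  have "commutator G u y
      = commutator G (commutator G v x) y \<otimes> commutator G (commutator G w y) y"
    using vw x y G commutator_in_A by (simp add: commutator_mult_A)
  also have "commutator G (commutator G v x) y = commutator G (commutator G v y) x"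
    using commutator_commutator_commute[OF A(1) x y] .
  also have "commutator G (commutator G v y) x \<otimes> commutator G (commutator G w y) y
      \<in> lower_central G (Suc (Suc (Suc j)))"
    using commutator_in_lower_central[OF _ step.IH[OF vw(1)] x]
      commutator_in_lower_central[OF _ step.IH[OF vw(2)] y]
    by (intro subgroup.m_closed[OF lower_central_subgroup]) simp_all
  finally show ?case .
qed

end

text \<open>Stated for any \<open>x\<close> that generates \<open>G\<close> together with \<open>y\<close>, so that it can be interpreted again
  with \<open>x y\<^sup>e\<close> in place of \<open>x\<close>.\<close>

locale two_step_generated = metabelian_two_generated +
  fixes m
  assumes y_chi: "y \<in> two_step_centralizer G"
    and lower_central_m: "lower_central G m = {\<one>}" and m_ge_3: "3 \<le> m"
begin

text \<open>Write \<open>w \<in> \<gamma>\<^sub>j\<^sub>+\<^sub>1\<close> as \<open>[u, x] [v, y]\<close>. The error term \<open>[v, y]\<close> lies in \<open>\<gamma>\<^sub>j\<^sub>+\<^sub>2\<close>, which is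
  \<open>D\<^sub>x \<gamma>\<^sub>j\<^sub>+\<^sub>1\<close> by downward induction, so it can be absorbed: \<open>w = [u u', x]\<close>.\<close>

lemma ad_image_lower_central:
  assumes "2 \<le> j" "j \<le> m"
  shows "ad_image x (lower_central G j) = lower_central G (Suc j)"
  using assms(2,1)
proof (induction rule: inc_induct)
  case base
  then show ?case
    using x lower_central_m lower_central_trivial[of m "Suc m"]
    by (simp add: ad_image_def commutator_eq_one_iff)
next
  case (step j)
  show ?case
  proof
    show "lower_central G (Suc j) \<subseteq> ad_image x (lower_central G j)"
    proof
      fix w assume "w \<in> lower_central G (Suc j)"
      then obtain u v where uv: "u \<in> lower_central G j" "v \<in> lower_central G j"
        "w = commutator G u x \<otimes> commutator G v y"
        using lower_central_Suc_decompose[OF step.prems] by blast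
      have "commutator G v y \<in> lower_central G (Suc (Suc j))"
        using two_step_centralizer_raises_by_two[OF y_chi step.prems uv(2)] .
      then obtain u' where u': "u' \<in> lower_central G (Suc j)" "commutator G v y = commutator G u' x"
        using step.IH step.prems by (auto simp: ad_image_def)
      have u'j: "u' \<in> lower_central G j" using u' lower_central_decseq[of j "Suc j"] by auto
      then have "w = commutator G (u \<otimes> u') x"
        using uv u' lower_central_subset_A[OF step.prems] x
        by (simp add: commutator_mult_A subset_iff)
      moreover have "u \<otimes> u' \<in> lower_central G j"
        using uv u'j subgroup.m_closed[OF lower_central_subgroup] by blast
      ultimately show "w \<in> ad_image x (lower_central G j)" by (auto simp: ad_image_def)
    qed
  qed (use x step.prems in \<open>auto intro: ad_image_subset [THEN subsetD]\<close>)
qed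

abbreviation "\<sigma> \<equiv> iterated_commutator G x y"

lemma s_Suc: "1 \<le> i \<Longrightarrow> \<sigma> (Suc i) = commutator G (\<sigma> i) x"
  by (cases i) auto

lemma s_in_lower_central: "1 \<le> i \<Longrightarrow> \<sigma> i \<in> lower_central G i"
proof (induction rule: dec_induct)
  case (step i)
  then show ?case using x by (simp add: s_Suc commutator_in_lower_central)
qed (simp add: y)

text \<open>For \<open>j = 2\<close> this holds because \<open>s\<^sub>2 = [y, x]\<close> is the only commutator of the generators up to
  inversion; applying \<open>D\<^sub>x\<close> raises all indices by one.\<close>

lemma lower_central_subset_generate_insert:
  assumes "2 \<le> j" "j \<le> m"
  shows "lower_central G j \<subseteq> generate G (insert (\<sigma> j) (lower_central G (Suc j)))"
  using assms
proof (induction rule: dec_induct)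
  case base
  let ?H = "generate G (insert (\<sigma> 2) (lower_central G 3))"
  have incl: "insert (\<sigma> 2) (lower_central G 3) \<subseteq> A"
    using s_in_lower_central[of 2] lower_central_decseq[of 2 3] by auto
  then have incl_G: "insert (\<sigma> 2) (lower_central G 3) \<subseteq> carrier G"
    using lower_central_carrier by blast
  have H: "subgroup ?H G" using incl_G by (rule generate_is_subgroup)
  interpret H: subgroup ?H G by fact
  have yx: "commutator G y x \<in> ?H"
    by (rule generate.incl) (simp add: numeral_2_eq_2)
  then have "inv (commutator G y x) \<in> ?H" by simp
  then have xy: "commutator G x y \<in> ?H" using x y by (simp add: inv_commutator)
  have "commutator G a b \<in> ?H" if "a \<in> {x, y}" "b \<in> {x, y}" for a b
    using that xy yx x y commutator_eq_one_iff[of x x] commutator_eq_one_iff[of y y] H.one_closed by auto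
  then have "A \<subseteq> ?H"
    using x y H incl by (intro derived_subset_if_generators[OF gen] generate_subgroup_incl
        lower_central_subgroup) (auto intro: generate.incl)
  then show ?case by (simp add: numeral_3_eq_3 numeral_2_eq_2)
next
  case (step j)
  have incl: "insert (\<sigma> i) (lower_central G (Suc i)) \<subseteq> A" if "2 \<le> i" for i
    using that s_in_lower_central[of i] lower_central_subset_A[of i] lower_central_subset_A[of "Suc i"] by auto
  then have incl_G: "insert (\<sigma> i) (lower_central G (Suc i)) \<subseteq> carrier G" if "2 \<le> i" for i
    using that lower_central_carrier by blast
  let ?H = "generate G (insert (\<sigma> (Suc j)) (lower_central G (Suc (Suc j))))"
  have H: "subgroup ?H G" using step incl_G[of "Suc j"] by (intro generate_is_subgroup) simp
  have gens: "commutator G t x \<in> ?H" if "t \<in> insert (\<sigma> j) (lower_central G (Suc j))" for t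
    using that x step.hyps s_Suc[of j] commutator_in_lower_central[of "Suc j" t x]
    by (auto intro: generate.incl)
  have "lower_central G (Suc j) = ad_image x (lower_central G j)"
    using step by (simp add: ad_image_lower_central)
  also have "\<dots> \<subseteq> ?H"
    using step commutator_generate_A[OF H incl[OF step.hyps(1)] x gens] by (auto simp: ad_image_def)
  finally show ?case .
qed

lemma lower_central_eq_generate:
  assumes "2 \<le> j" "j \<le> m"
  shows "lower_central G j = generate G (\<sigma> ` {j..m - 1})"
  using assms(2,1)
proof (induction rule: inc_induct)
  case base
  have "{m..m - 1} = {}" using m_ge_3 by simp
  then show ?case by (simp only: lower_central_m image_empty generate_empty)
next
  case (step j)
  have s_sub: "\<sigma> ` {j..m - 1} \<subseteq> lower_central G j"
    using step.prems s_in_lower_central lower_central_decseq[of j] by fastforce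
  then have s_G: "\<sigma> ` {j..m - 1} \<subseteq> carrier G" using lower_central_carrier by blast
  have "generate G (\<sigma> ` {Suc j..m - 1}) \<subseteq> generate G (\<sigma> ` {j..m - 1})"
    by (intro mono_generate) auto
  moreover have "\<sigma> j \<in> generate G (\<sigma> ` {j..m - 1})"
    using step.hyps by (intro generate.incl) auto
  ultimately have "generate G (insert (\<sigma> j) (lower_central G (Suc j))) \<subseteq> generate G (\<sigma> ` {j..m - 1})"
    using step s_G by (intro generate_subgroup_incl generate_is_subgroup) auto
  then show ?case
    using lower_central_subset_generate_insert[of j] step
      generate_subgroup_incl[OF s_sub lower_central_subgroup] by auto
qed

end

section \<open>Maximal subgroups of a metabelian group of maximal class\<close>

lemma (in group) subgroup_maximal_subgroup:
  assumes "y \<in> carrier G"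
  shows "subgroup (maximal_subgroup G x y 1) G"
  unfolding maximal_subgroup_def maximal_subgroup_gen_def
  using assms derived_in_carrier[of "carrier G"] by (intro generate_is_subgroup) auto

locale metabelian_maximal_class = maximal_class_group + metabelian_group +
  fixes x y
  assumes x_chi: "x \<in> carrier G - two_step_centralizer G"
    and y_chi': "y \<in> two_step_centralizer G - derived G (carrier G)"
    and gen': "generate G {x, y} = carrier G"
begin

sublocale two_step_generated G x y m
  using x_chi y_chi' gen' m_ge_3 lower_central_eq_one[of m]
  by unfold_locales (auto simp: two_step_centralizer_def)

text \<open>The terms of the lower central series below \<open>G'\<close> are the only subgroups of \<open>G'\<close> that
  are normal in \<open>G\<close>: such a subgroup \<open>N\<close> with \<open>N \<subseteq> \<gamma>\<^sub>j\<close> and \<open>\<not> N \<subseteq> \<gamma>\<^sub>j\<^sub>+\<^sub>1\<close> satisfies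
  \<open>\<gamma>\<^sub>j = N \<gamma>\<^sub>j\<^sub>+\<^sub>1\<close>, since \<open>\<gamma>\<^sub>j\<^sub>+\<^sub>1\<close> has index \<open>p\<close> in \<open>\<gamma>\<^sub>j\<close>, and commutation with \<open>x\<close>
  turns this into \<open>\<gamma>\<^sub>i \<subseteq> N \<gamma>\<^sub>i\<^sub>+\<^sub>1\<close> for all \<open>i \<ge> j\<close>.\<close>

lemma normal_subgroup_of_A:
  assumes N: "N \<lhd> G" "N \<subseteq> A"
  obtains j where "2 \<le> j" "j \<le> m" "N = lower_central G j"
proof -
  interpret N: normal N G by fact
  let ?J = "{j. 2 \<le> j \<and> j \<le> m \<and> N \<subseteq> lower_central G j}"
  define j where "j = Max ?J"
  have "finite ?J" by (rule finite_subset[of _ "{..m}"]) auto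
  moreover have "2 \<in> ?J" using N m_ge_3 by auto
  ultimately have "j \<in> ?J" and max: "\<And>i. i \<in> ?J \<Longrightarrow> i \<le> j"
    unfolding j_def using Max_in[of ?J] Max_ge[of ?J] by blast+
  then have j: "2 \<le> j" "j \<le> m" "N \<subseteq> lower_central G j" by auto
  have "lower_central G j \<subseteq> N"
  proof (cases "j = m")
    case True
    then show ?thesis using lower_central_m N.one_closed by simp
  next
    case False
    then have jm: "j < m" using j by simp
    have not_sub: "\<not> N \<subseteq> lower_central G (Suc j)"
      using max[of "Suc j"] j jm by auto
    interpret L: normal "lower_central G (Suc j)" G by (rule lower_central_normal)
    let ?H = "N <#> lower_central G (Suc j)"
    have H: "subgroup ?H G"
      by (rule mult_norm_subgroup[OF N(1) L.is_subgroup])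
    have "\<one> \<otimes> v \<in> ?H" if "v \<in> lower_central G (Suc j)" for v
      using that N.one_closed unfolding set_mult_def by blast
    then have 1: "lower_central G (Suc j) \<subseteq> ?H" using L.mem_carrier by fastforce
    have "n \<otimes> \<one> \<in> ?H" if "n \<in> N" for n
      using that L.one_closed unfolding set_mult_def by blast
    then have "N \<subseteq> ?H" using N.mem_carrier by fastforce
    moreover have "?H \<subseteq> lower_central G j"
      using j(3) lower_central_decseq[of j "Suc j"]
      by (auto simp: set_mult_def intro!: subgroup.m_closed[OF lower_central_subgroup])
    ultimately have base: "?H = lower_central G j"
      using 1 not_sub by (intro subgroup_above_lower_central_Suc j jm H) auto
    have mult: "lower_central G i \<subseteq> N <#> lower_central G (Suc i)" if "j \<le> i" "i \<le> m" for i
      using that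
    proof (induction rule: dec_induct)
      case (step i)
      show ?case
      proof
        fix w assume "w \<in> lower_central G (Suc i)"
        moreover have "2 \<le> i" "i \<le> m" using j step by auto
        ultimately have "w \<in> ad_image x (lower_central G i)"
          by (simp only: ad_image_lower_central)
        then obtain u where u: "u \<in> lower_central G i" "w = commutator G u x"
          by (auto simp: ad_image_def)
        then obtain n v where nv: "n \<in> N" "v \<in> lower_central G (Suc i)" "u = n \<otimes> v"
          using step by (auto simp: set_mult_def)
        then have "v \<in> A"
          using lower_central_subset_A[of "Suc i"] j step by auto
        then have "w = commutator G n x \<otimes> commutator G v x"
          using u nv N x by (simp add: commutator_mult_A subset_iff)
        moreover have "commutator G n x \<in> N"
          using nv N x commutator_in_normal by blast
        moreover have "commutator G v x \<in> lower_central G (Suc (Suc i))"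
          using nv x j step by (intro commutator_in_lower_central) auto
        ultimately show "w \<in> N <#> lower_central G (Suc (Suc i))"
          by (auto simp: set_mult_def)
      qed
    qed (simp add: base)
    show ?thesis
      using j(2) order.refl[of j]
    proof (induction rule: inc_induct)
      case base
      then show ?case using lower_central_m N.one_closed by simp
    next
      case (step i)
      then show ?case
        using mult[of i] by (auto simp: set_mult_def)
    qed
  qed
  then show thesis using that j by blast
qed

text \<open>The two-step centralizer is a subgroup that contains \<open>\<langle>y, G'\<rangle>\<close> but not \<open>x\<close>, and \<open>\<langle>y, G'\<rangle>\<close> has
  index \<open>p\<close> in \<open>G\<close>.\<close>

lemma two_step_centralizer_eq: "two_step_centralizer G = generate G (insert y A)"
proof -
  let ?K = "generate G (insert y A)" and ?C = "two_step_centralizer G"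
  have y_notin: "y \<notin> A" using y_chi' by (simp add: lower_central_2)
  note K = lower_central_2_psubset_generate[OF y y_notin]
  have C_eq: "?C = (\<Inter>u\<in>A. {g \<in> carrier G. commutator G g u \<in> lower_central G 4})"
    using subgroup.one_closed[OF lower_central_subgroup] by (auto simp: two_step_centralizer_def)
  have C: "subgroup ?C G"
    unfolding C_eq
    using subgroup.one_closed[OF lower_central_subgroup]
    by (intro subgroups_Inter) (auto intro: subgroup_centralizer_mod lower_central_normal lower_central_carrier)
  have "A \<subseteq> ?C"
    using subgroup.one_closed[OF lower_central_subgroup] lower_central_carrier
    by (auto simp: two_step_centralizer_def commutator_eq_one)
  then have K_sub: "?K \<subseteq> ?C"
    using y_chi by (intro generate_subgroup_incl C) auto
  have "?C \<subset> carrier G"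
    using x_chi subgroup.subset[OF C] by auto
  then have "p * card ?C \<le> p ^ m"
    using card_proper_subgroup[OF C subgroup_self] order_G by (simp add: order_def)
  also have "\<dots> = p * (p * card A)"
    using card_lower_central_2 order_split by (simp add: power2_eq_square)
  also have "\<dots> \<le> p * card ?K"
    using card_proper_subgroup[OF lower_central_subgroup K(1,2)] by simp
  finally have "card ?C \<le> card ?K"
    using prime_gt_0_nat[OF prime_p] by simp
  then show ?thesis
    using card_seteq[OF finite_subgroup[OF C] K_sub] by simp
qed

lemma derived_maximal_subgroup_1:
  obtains j where "2 \<le> j" "j \<le> m" "derived G (maximal_subgroup G x y 1) = lower_central G j"
    "commutator_subgroup G (two_step_centralizer G) A = lower_central G j"
proof -
  have "maximal_subgroup G x y 1 = generate G (insert y A)"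
    by (simp add: maximal_subgroup_def maximal_subgroup_gen_def lower_central_2)
  then have 1: "derived G (maximal_subgroup G x y 1) = ad_image y A"
    using derived_generate_insert_A[OF y] by simp
  have "ad_image y A \<lhd> G"
    using y by (intro ad_image_normal lower_central_normal) auto
  moreover have "ad_image y A \<subseteq> A"
    using y lower_central_carrier commutator_in_A by (auto simp: ad_image_def)
  ultimately obtain j where "2 \<le> j" "j \<le> m" "ad_image y A = lower_central G j"
    by (rule normal_subgroup_of_A)
  then show thesis
    using that[of j] 1 commutator_generate_insert_A(2)[OF y] two_step_centralizer_eq by simp
qed

text \<open>The bound guarantees \<open>m - k \<ge> 2\<close>, where the description of \<open>\<gamma>\<^sub>m\<^sub>-\<^sub>k\<close> by the \<open>s\<^sub>j\<close> is available.\<close>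

lemma derived_maximal_subgroup_1_eq:
  shows "derived G (maximal_subgroup G x y 1) = lower_central G (m - invariant_k G m)"
    and "invariant_k G m \<le> m - 2"
proof -
  obtain j where j: "2 \<le> j" "j \<le> m" "derived G (maximal_subgroup G x y 1) = lower_central G j"
    "commutator_subgroup G (two_step_centralizer G) A = lower_central G j"
    by (rule derived_maximal_subgroup_1)
  have "invariant_k G m = m - j"
    unfolding invariant_k_def
  proof (rule the_equality)
    show "m - j < m \<and> commutator_subgroup G (two_step_centralizer G) A = lower_central G (m - (m - j))"
      using j by auto
    fix k assume "k < m \<and> commutator_subgroup G (two_step_centralizer G) A = lower_central G (m - k)"
    then show "k = m - j"
      using j lower_central_inj[of j "m - k"] by auto
  qed
  then show "derived G (maximal_subgroup G x y 1) = lower_central G (m - invariant_k G m)"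
    and "invariant_k G m \<le> m - 2"
    using j by auto
qed

text \<open>The generator \<open>x y\<^sup>i\<^sup>-\<^sup>2\<close> of \<open>U\<^sub>i\<close> generates \<open>G\<close> together with \<open>y\<close>, so it can take the place of
  \<open>x\<close> in \<open>D\<^sub>x \<gamma>\<^sub>2 = \<gamma>\<^sub>3\<close>.\<close>

lemma derived_maximal_subgroup_ge_2:
  assumes i: "2 \<le> i"
  shows "derived G (maximal_subgroup G x y i) = lower_central G 3"
proof -
  let ?z = "y [^] (i - 2)"
  let ?x = "x \<otimes> ?z"
  have x': "?x \<in> carrier G" using x y by simp
  interpret xy': subgroup "generate G {?x, y}" G
    using x' y by (intro generate_is_subgroup) auto
  have y_gen: "y \<in> generate G {?x, y}" by (rule generate.incl) simp
  have "?z \<in> generate G {?x, y}"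
    using subgroup_int_pow_closed[OF xy'.subgroup_axioms y_gen, of "int (i - 2)"]
    by (simp add: int_pow_int)
  moreover have "?x \<in> generate G {?x, y}" by (rule generate.incl) simp
  ultimately have "?x \<otimes> inv ?z \<in> generate G {?x, y}" by blast
  then have "x \<in> generate G {?x, y}" using x y by (simp add: m_assoc)
  then have "generate G {x, y} \<subseteq> generate G {?x, y}"
    using y_gen by (intro generate_subgroup_incl xy'.subgroup_axioms) auto
  then have gen_x': "generate G {?x, y} = carrier G"
    using gen xy'.subset by auto
  interpret x': two_step_generated G ?x y m
    using x' gen_x' y y_chi lower_central_m m_ge_3 by unfold_locales
  have "maximal_subgroup G x y i = generate G (insert ?x A)"
    using i by (simp add: maximal_subgroup_def maximal_subgroup_gen_def lower_central_2)
  then show ?thesis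
    using derived_generate_insert_A[OF x'] x'.ad_image_lower_central[of 2] m_ge_3
    by (simp add: numeral_3_eq_3 numeral_2_eq_2)
qed

end

section \<open>Stabilization and polarization\<close>

lemma kernel_natural_projection:
  assumes "group G" and N: "N \<lhd> G"
  shows "kernel G (G Mod N) (natural_projection G N) = N"
proof -
  interpret N: normal N G by fact
  show ?thesis
    using N.coset_eq_iff[of _ "\<one>\<^bsub>G\<^esub>"] N.subset
    by (auto simp: kernel_def natural_projection_def)
qed


theorem theorem6p2:
  fixes G :: "('a, 'b) monoid_scheme" and p m c k :: nat and x y :: 'a
    and s :: "nat \<Rightarrow> 'a" and U :: "nat \<Rightarrow> 'a set" and \<pi> :: "'a \<Rightarrow> 'a set"
    and Stb Pol :: "nat set"
  assumes "group G" and "Factorial_Ring.prime p" and "order G = p ^ m"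
    and "metabelian G"
    and "nilpotency_class G = c" and "c = m - 1" and "c \<ge> 3"
    and "coclass p G = 1"
    and "k = invariant_k G m"
    and "x \<in> carrier G - two_step_centralizer G"
    and "y \<in> two_step_centralizer G - derived G (carrier G)"
    and "generate G {x, y} = carrier G"
    and "s = iterated_commutator G x y"
    and "U = maximal_subgroup G x y"
    and "\<pi> = natural_projection G (lower_central G c)"
    and "Stb = stabilization G (G Mod lower_central G c) \<pi> {1..p+1} U"
    and "Pol = polarization G (G Mod lower_central G c) \<pi> {1..p+1} U"
  shows "(G Mod derived G (carrier G)) \<cong> (integer_mod_group p \<times>\<times> integer_mod_group p)
    \<and> (comm_group (G\<lparr>carrier := U 1\<rparr>) \<longrightarrow> Pol = {1} \<and> Stb = {2..p+1})
    \<and> ((Pol = {1} \<and> Stb = {2..p+1}) \<longleftrightarrow> (derived G (U 1) = {\<one>\<^bsub>G\<^esub>} \<and> k = 0))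
    \<and> ((\<forall>i \<in> {1..p+1}. \<not> comm_group (G\<lparr>carrier := U i\<rparr>)) \<longrightarrow> Pol = {} \<and> Stb = {1..p+1})
    \<and> ((Pol = {} \<and> Stb = {1..p+1}) \<longleftrightarrow>
        (derived G (U 1) = generate G (s ` {m - k..m - 1})
         \<and> generate G (s ` {m - k..m - 1}) = lower_central G (m - k) \<and> k \<ge> 1))
    \<and> (\<forall>i \<in> {2..p+1}. derived G (U i) = generate G (s ` {3..m - 1})
         \<and> generate G (s ` {3..m - 1}) = lower_central G 3)"
proof -
  have m: "4 \<le> m" using assms(6,7) by simp
  interpret metabelian_maximal_class G p m x y
    using assms m
    by (intro metabelian_maximal_class.intro maximal_class_group.intro p_group.intro
        p_group_axioms.intro maximal_class_group_axioms.intro metabelian_group.intro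
        metabelian_group_axioms.intro metabelian_maximal_class_axioms.intro) simp_all
  have U_i: "derived G (U i) = lower_central G 3" if "i \<in> {2..p + 1}" for i
    using that assms(14) derived_maximal_subgroup_ge_2 by simp
  have U_1: "derived G (U 1) = lower_central G (m - k)" and k: "k \<le> m - 2"
    using derived_maximal_subgroup_1_eq assms(9,14) by simp_all
  have c_nontrivial: "lower_central G c \<noteq> {\<one>\<^bsub>G\<^esub>}"
    using lower_central_nontrivial[of c] assms(5,7) by simp
  have ker: "kernel G (G Mod lower_central G c) \<pi> = lower_central G c"
    using kernel_natural_projection[OF assms(1) lower_central_normal] assms(15) by simp
  have stable_i: "lower_central G c \<subseteq> derived G (U i)" if "i \<in> {2..p + 1}" for i
    using U_i[OF that] lower_central_decseq[of 3 c] assms(7) by simp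
  have U_1_trivial: "derived G (U 1) = {\<one>\<^bsub>G\<^esub>} \<longleftrightarrow> k = 0"
  proof
    assume "derived G (U 1) = {\<one>\<^bsub>G\<^esub>}"
    then have "lower_central G (m - k) = lower_central G m"
      using U_1 lower_central_m by simp
    moreover have "1 \<le> m - k" using k m by linarith
    ultimately have "m - k = m"
      using lower_central_inj[of "m - k" m] by simp
    then show "k = 0" using k m by linarith
  qed (use U_1 lower_central_m in simp)
  have stable_1: "lower_central G c \<subseteq> derived G (U 1) \<longleftrightarrow> 1 \<le> k"
  proof
    assume "lower_central G c \<subseteq> derived G (U 1)"
    then show "1 \<le> k"
      using U_1_trivial c_nontrivial subgroup.one_closed[OF lower_central_subgroup[of c]] by fastforce
  next
    assume "1 \<le> k"
    then show "lower_central G c \<subseteq> derived G (U 1)"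
      using U_1 lower_central_decseq[of "m - k" c] assms(6) by simp
  qed
  have Stb: "Stb = {i \<in> {1..p + 1}. lower_central G c \<subseteq> derived G (U i)}"
    and Pol: "Pol = {i \<in> {1..p + 1}. \<not> lower_central G c \<subseteq> derived G (U i)}"
    unfolding assms(16,17) stabilization_def polarization_def ker by (rule refl)+
  have split: "{1..p + 1} = insert 1 {2..p + 1}" by auto
  have Stb_Pol: "if k = 0 then Pol = {1} \<and> Stb = {2..p + 1} else Pol = {} \<and> Stb = {1..p + 1}"
    unfolding Stb Pol split using subsetD[OF stable_i] stable_1 by auto
  have "subgroup (U 1) G"
    unfolding assms(14) using y by (rule subgroup_maximal_subgroup)
  then have abelian_iff: "comm_group (G\<lparr>carrier := U 1\<rparr>) \<longleftrightarrow> k = 0"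
    using U_1_trivial by (simp add: comm_group_iff_derived_trivial)
  have gens: "derived G (U 1) = generate G (s ` {m - k..m - 1})
      \<and> generate G (s ` {m - k..m - 1}) = lower_central G (m - k)"
    using U_1 lower_central_eq_generate[of "m - k"] k m assms(13) by simp
  have gens_3: "generate G (s ` {3..m - 1}) = lower_central G 3"
    using lower_central_eq_generate[of 3] m assms(13) by simp
  have "(Pol = {1} \<and> Stb = {2..p + 1}) \<longleftrightarrow> k = 0" "(Pol = {} \<and> Stb = {1..p + 1}) \<longleftrightarrow> 1 \<le> k"
    using Stb_Pol by (auto split: if_splits)
  then show ?thesis
    using commutator_quotient_iso[OF x y gen] abelian_iff U_1_trivial gens gens_3 U_i by auto
qed

end
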